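(* Let $f(s)$ be an almost periodic function in a vertical strip $U=\{s=\sigma+it:\alpha<\sigma<\beta\}$, where $-\infty\le\alpha<\beta\le\infty$, whose Dirichlet series is given by $\sum_{n\ge1}a_ne^{\lambda_ns}$, where the set of Fourier exponents $\{\lambda_1,\lambda_2,\ldots\}$ is linearly independent over $\mathbb{Q}$ and has at least three elements. Let $\sigma_0\in(\alpha,\beta)$. Then $\sigma_0\in R_f$ if and only if $$|a_j|e^{\sigma_0\lambda_j}\le\sum_{i\ge1,\ i\ne j}|a_i|e^{\sigma_0\lambda_i}\quad\text{for every } j=1,2,\ldots.$$
   Context: Write $s=\sigma+it$ with $\sigma,t\in\mathbb{R}$. A function $f$, analytic in the vertical strip $U=\{\sigma+it:\alpha<\sigma<\beta\}$, is called almost periodic in $U$ if for every reduced strip $\{\alpha_1\le\sigma\le\beta_1\}$ with $\alpha<\alpha_1<\beta_1<\beta$ and every $\varepsilon>0$ there is $l>0$ such that each interval of length $l$ on the real line contains a number $\tau$ with $|f(s+i\tau)-f(s)|\le\varepsilon$ for all $s$ in the reduced strip. Equivalently, $f$ is a uniform limit, on every reduced strip of $U$, of exponential polynomials $a_1e^{\lambda_1s}+\cdots+a_ne^{\lambda_ns}$ with $a_j\in\mathbb{C}$, $\lambda_j\in\mathbb{R}$. Fourier exponents and Dirichlet series: for $\lambda\in\mathbb{R}$ the number $a(\lambda)=\lim_{T\to\infty}\frac1{2T}\int_{-T}^{T}f(\sigma+it)e^{-\lambda(\sigma+it)}\,dt$ exists and does not depend on $\sigma\in(\alpha,\beta)$.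 It is nonzero for at most countably many $\lambda$, called the Fourier exponents of $f$; enumerating them as $\lambda_1,\lambda_2,\ldots$ (distinct; finitely or infinitely many) and putting $a_n=a(\lambda_n)\neq0$, the series $\sum_{n\ge1}a_ne^{\lambda_ns}$ is the Dirichlet series of $f$. It is a known fact that if the Fourier exponents are linearly independent over $\mathbb{Q}$, the Dirichlet series converges absolutely to $f$ in $U$. The set $R_f$ is defined by $R_f:=\overline{\{\operatorname{Re}s: f(s)=0,\ s\in U\}}\cap(\alpha,\beta)$, where the bar denotes closure in $\mathbb{R}$. *)

theory Defs
  imports "HOL-Complex_Analysis.Complex_Analysis"
begin

text \<open>The endpoints of strips are extended reals, so half-planes and the whole plane are included.\<close>

definition vstrip :: "ereal \<Rightarrow> ereal \<Rightarrow> complex set" where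
  "vstrip \<alpha> \<beta> = {s. \<alpha> < ereal (Re s) \<and> ereal (Re s) < \<beta>}"

text \<open>Almost periodicity in the sense of Bohr, with relatively dense sets of vertical
  \<open>\<epsilon>\<close>-translation numbers on every reduced strip.\<close>

definition almost_periodic_strip :: "ereal \<Rightarrow> ereal \<Rightarrow> (complex \<Rightarrow> complex) \<Rightarrow> bool" where
  "almost_periodic_strip \<alpha> \<beta> f \<longleftrightarrow>
     f analytic_on vstrip \<alpha> \<beta> \<and>
     (\<forall>\<alpha>1 \<beta>1 :: real. \<alpha> < ereal \<alpha>1 \<and> \<alpha>1 < \<beta>1 \<and> ereal \<beta>1 < \<beta> \<longrightarrow>
       (\<forall>\<epsilon>>0. \<exists>l>0. \<forall>x::real. \<exists>\<tau>\<in>{x..x + l}.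
          \<forall>s. \<alpha>1 \<le> Re s \<and> Re s \<le> \<beta>1 \<longrightarrow>
            norm (f (s + \<i> * complex_of_real \<tau>) - f s) \<le> \<epsilon>))"

text \<open>For a function that is almost periodic in the strip, the limit exists for every abscissa
  in the strip and is the same for all of them; the definite description picks this value.\<close>

definition fourier_coeff :: "ereal \<Rightarrow> ereal \<Rightarrow> (complex \<Rightarrow> complex) \<Rightarrow> real \<Rightarrow> complex" where
  "fourier_coeff \<alpha> \<beta> f l =
     (THE c. \<forall>\<sigma>::real. \<alpha> < ereal \<sigma> \<and> ereal \<sigma> < \<beta> \<longrightarrow>
        ((\<lambda>T::real. complex_of_real (1 / (2 * T)) *
            integral {-T..T}
              (\<lambda>t. f (Complex \<sigma> t) * exp (- complex_of_real l * Complex \<sigma> t))) \<longlongrightarrow> c) at_top)"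

definition fourier_exponents :: "ereal \<Rightarrow> ereal \<Rightarrow> (complex \<Rightarrow> complex) \<Rightarrow> real set" where
  "fourier_exponents \<alpha> \<beta> f = {l. fourier_coeff \<alpha> \<beta> f l \<noteq> 0}"

text \<open>The terms \<open>a n * exp (lam n * s)\<close>, \<open>n \<in> I\<close>, enumerate the Dirichlet series of \<open>f\<close> without
  repetition.  The index set \<open>I\<close> may be finite or infinite.\<close>

definition is_dirichlet_series ::
  "ereal \<Rightarrow> ereal \<Rightarrow> (complex \<Rightarrow> complex) \<Rightarrow> nat set \<Rightarrow> (nat \<Rightarrow> complex) \<Rightarrow> (nat \<Rightarrow> real) \<Rightarrow> bool" where
  "is_dirichlet_series \<alpha> \<beta> f I a lam \<longleftrightarrow>
     bij_betw lam I (fourier_exponents \<alpha> \<beta> f) \<and>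
     (\<forall>n\<in>I. a n = fourier_coeff \<alpha> \<beta> f (lam n))"

definition zero_abscissae :: "ereal \<Rightarrow> ereal \<Rightarrow> (complex \<Rightarrow> complex) \<Rightarrow> real set" where
  "zero_abscissae \<alpha> \<beta> f =
     closure (Re ` {s \<in> vstrip \<alpha> \<beta>. f s = 0}) \<inter> {\<sigma>. \<alpha> < ereal \<sigma> \<and> ereal \<sigma> < \<beta>}"

interpretation rat_real: vector_space "\<lambda>(q::rat) (x::real). of_rat q * x"
  by unfold_locales (simp_all add: algebra_simps of_rat_add of_rat_mult)

end

theory Submission
  imports Defs
begin

text \<open>Write \<open>r n = |a n| * exp (\<sigma>\<^sub>0 * lam n)\<close>. By independence, a Riesz product argument bounds the
  finite sums of the \<open>r n\<close>, and the uniqueness theorem for almost periodic functions then shows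
  that \<open>f\<close> is the sum of its absolutely convergent Dirichlet series. If one term exceeds the sum
  of the others at \<open>\<sigma>\<^sub>0\<close>, then it does so at all nearby abscissae, where \<open>f\<close> therefore has no zero.
  Otherwise the \<open>r n\<close> are the side lengths of a closed polygon, so that suitable unimodular
  factors \<open>cis (\<phi> n)\<close> make the series with coefficients \<open>a n * cis (\<phi> n)\<close> vanish at \<open>\<sigma>\<^sub>0\<close>. By
  Kronecker's theorem this series is the uniform limit of vertical translates of \<open>f\<close>, and by
  Hurwitz's theorem those translates have zeros with abscissae close to \<open>\<sigma>\<^sub>0\<close>.\<close>

section \<open>Almost periodic functions on the line\<close>

text \<open>Almost periodicity is given only through translation numbers, so mean values, uniqueness
  and absolute convergence all have to be drawn from these. Uniqueness is the costly step: from a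
  nonzero value one must produce a nonzero Fourier mean. Sampling on a lattice turns this into a
  statement about finite sequences, where Parseval is pure algebra; the price is that the
  trigonometric sums must be small uniformly in the frequency. For absolute convergence, a
  nonnegative kernel of mean 1 tested against \<open>f\<close> on one vertical line yields at most
  the supremum of \<open>|f|\<close>, while the Riesz product returns half the sum of the chosen
  \<open>r n\<close>; hence a bound independent of how many exponents are chosen. The criterion is
  carried as \<open>2 * r j \<le> suminf r\<close>, the polygon inequality with \<open>r j\<close>
  added to both sides.\<close>

text \<open>Bochner's form of almost periodicity: the translates are totally bounded in the sup norm.
  Unlike Bohr's form it is evidently stable under sums and products.\<close>

definition ap :: "(real \<Rightarrow> complex) \<Rightarrow> bool" where
  "ap F \<longleftrightarrow> continuous_on UNIV F \<and>
     (\<forall>e>0. \<exists>A. finite A \<and> (\<forall>t. \<exists>a\<in>A. \<forall>x. norm (F (x + t) - F (x + a)) \<le> e))"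

definition has_mean :: "(real \<Rightarrow> complex) \<Rightarrow> complex \<Rightarrow> bool" where
  "has_mean G L \<longleftrightarrow>
     ((\<lambda>T. complex_of_real (1 / (2 * T)) * integral {-T..T} G) \<longlongrightarrow> L) at_top"

lemma ap_continuous: "ap F \<Longrightarrow> continuous_on S F"
  unfolding ap_def using continuous_on_subset by blast

lemma ap_finite_translates:
  assumes "ap F" "e > 0"
  obtains A where "finite A" "\<And>t. \<exists>a\<in>A. \<forall>x. norm (F (x + t) - F (x + a)) \<le> e"
  using assms unfolding ap_def by blast

lemma ap_bounded:
  assumes "ap F" obtains B where "B > 0" "\<And>x. norm (F x) \<le> B"
proof -
  obtain A where A: "finite A" "\<And>t. \<exists>a\<in>A. \<forall>x. norm (F (x + t) - F (x + a)) \<le> 1"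
    using ap_finite_translates[OF assms, of 1] by auto
  define B where "B = 1 + (\<Sum>a\<in>A. norm (F a))"
  have "norm (F t) \<le> B" for t
  proof -
    obtain a where a: "a \<in> A" "\<forall>x. norm (F (x + t) - F (x + a)) \<le> 1" using A(2) by blast
    have "norm (F t) \<le> 1 + norm (F a)"
      using a(2)[rule_format, of 0] norm_triangle_ineq2[of "F t" "F a"] by simp
    moreover have "norm (F a) \<le> (\<Sum>a\<in>A. norm (F a))"
      using a(1) A(1) by (intro member_le_sum) auto
    ultimately show ?thesis unfolding B_def by linarith
  qed
  moreover have "B > 0" unfolding B_def by (simp add: add_pos_nonneg sum_nonneg)
  ultimately show ?thesis using that by blast
qed

text \<open>Up to \<open>e/3\<close>, the graph near any point looks like the graph near one of the
  finitely many points of \<open>A\<close>, and continuity at finitely many points has a common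
  modulus.\<close>

lemma ap_uniformly_continuous:
  assumes "ap F" "e > 0"
  obtains d where "d > 0" "\<And>x y. \<bar>x - y\<bar> < d \<Longrightarrow> norm (F x - F y) \<le> e"
proof -
  obtain A where A: "finite A" "\<And>t. \<exists>a\<in>A. \<forall>x. norm (F (x + t) - F (x + a)) \<le> e/3"
    using ap_finite_translates[OF assms(1), of "e/3"] assms(2) by auto
  have "\<exists>d>0. \<forall>x. \<bar>x\<bar> < d \<longrightarrow> norm (F (x + a) - F a) \<le> e/3" for a
  proof -
    have "isCont F a" using assms(1) unfolding ap_def by (simp add: continuous_on_eq_continuous_at)
    then obtain d where "d > 0" "\<And>x. dist x a < d \<Longrightarrow> dist (F x) (F a) < e/3"
      using assms(2) unfolding continuous_at_eps_delta by (metis zero_less_divide_iff zero_less_numeral)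
    then show ?thesis
      by (intro exI[of _ d]) (auto simp: dist_norm intro: less_imp_le)
  qed
  then obtain d where d: "\<And>a. d a > 0" "\<And>a x. \<bar>x\<bar> < d a \<Longrightarrow> norm (F (x + a) - F a) \<le> e/3"
    by metis
  define D where "D = Min (insert 1 (d ` A))"
  have "D > 0" unfolding D_def using A(1) d(1) by (subst Min_gr_iff) auto
  moreover have "norm (F x - F y) \<le> e" if "\<bar>x - y\<bar> < D" for x y
  proof -
    obtain a where a: "a \<in> A" "\<forall>x. norm (F (x + y) - F (x + a)) \<le> e/3" using A(2) by blast
    have "D \<le> d a" unfolding D_def using a(1) A(1) by (intro Min_le) auto
    then have "norm (F ((x-y) + a) - F a) \<le> e/3" using d(2) that by force
    moreover have "norm (F x - F ((x-y) + a)) \<le> e/3" using a(2)[rule_format, of "x-y"] by simp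
    moreover have "norm (F y - F a) \<le> e/3" using a(2)[rule_format, of 0] by simp
    ultimately show ?thesis
      using norm_triangle_ineq[of "F x - F ((x-y) + a)" "(F ((x-y) + a) - F a) - (F y - F a)"]
        norm_triangle_ineq4[of "F ((x-y) + a) - F a" "F y - F a"] by simp
  qed
  ultimately show ?thesis using that by blast
qed

text \<open>Bohr's form implies Bochner's: a translation number moves any \<open>t\<close> into
  \<open>{0..l}\<close>, where the multiples of a small \<open>d\<close> form a finite net. For a
  net point to serve all \<open>x\<close> at once, \<open>F\<close> must be uniformly continuous on
  the whole line; this follows by moving two close points into a compact interval.\<close>

lemma ap_bohr:
  assumes cont: "continuous_on UNIV F"
    and bohr: "\<And>e. e > 0 \<Longrightarrow> \<exists>l>0. \<forall>x. \<exists>\<tau>\<in>{x..x + l}. \<forall>t. norm (F (t + \<tau>) - F t) \<le> e"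
  shows "ap F"
  unfolding ap_def
proof (intro conjI cont allI impI)
  fix e :: real assume "e > 0"
  obtain l where l: "l > 0" "\<And>x. \<exists>\<tau>\<in>{x..x + l}. \<forall>t. norm (F (t + \<tau>) - F t) \<le> e/4"
    using bohr[of "e/4"] \<open>e > 0\<close> by auto
  \<comment> \<open>The moved point lies in \<open>{0..l}\<close> and increments stay below 1 in
    modulus, so one unit of room on each side suffices.\<close>
  have "uniformly_continuous_on {-1..l + 1} F"
    using cont by (intro compact_uniformly_continuous) (auto intro: continuous_on_subset)
  then obtain d0 where d0: "d0 > 0"
    "\<And>x y. x \<in> {-1..l+1} \<Longrightarrow> y \<in> {-1..l+1} \<Longrightarrow> dist x y < d0 \<Longrightarrow> dist (F x) (F y) < e/4"
    unfolding uniformly_continuous_on_def using \<open>e > 0\<close> by (metis zero_less_divide_iff zero_less_numeral)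
  define d where "d = min d0 1"
  have dd: "d > 0" "d \<le> 1" using d0 by (auto simp: d_def)
  have uc: "norm (F (x + s) - F x) \<le> 3 * (e/4)" if "\<bar>s\<bar> < d" for x s
  proof -
    obtain \<tau> where \<tau>: "\<tau> \<in> {-x..-x + l}" "\<And>t. norm (F (t + \<tau>) - F t) \<le> e/4" using l(2) by blast
    have "dist (F (x + \<tau> + s)) (F (x + \<tau>)) < e/4"
      using \<tau>(1) that dd by (intro d0(2)) (auto simp: d_def dist_norm)
    moreover have "norm (F (x + s + \<tau>) - F (x + s)) \<le> e/4" "norm (F (x + \<tau>) - F x) \<le> e/4" using \<tau>(2) by auto
    ultimately show ?thesis
      using norm_triangle_ineq[of "F (x + \<tau> + s) - F (x + \<tau>)" "(F (x + \<tau>) - F x) - (F (x + s + \<tau>) - F (x + s))"]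
        norm_triangle_ineq4[of "F (x + \<tau>) - F x" "F (x + s + \<tau>) - F (x + s)"]
      by (simp add: dist_norm algebra_simps)
  qed
  obtain n :: nat where n: "real n * d > l" using reals_Archimedean3[OF dd(1)] by blast
  define A where "A = (\<lambda>k. real k * d) ` {..n}"
  have "\<exists>a\<in>A. \<forall>x. norm (F (x + t) - F (x + a)) \<le> e" for t
  proof -
    obtain \<tau> where \<tau>: "\<tau> \<in> {-t..-t + l}" "\<And>t. norm (F (t + \<tau>) - F t) \<le> e/4" using l(2) by blast
    \<comment> \<open>Rounding \<open>t + \<tau>\<close> down to the lattice leaves an error below
      \<open>d\<close>, and \<open>n * d > l\<close> bounds the index.\<close>
    define k where "k = nat \<lfloor>(t + \<tau>) / d\<rfloor>"
    have nn: "0 \<le> (t + \<tau>) / d" using \<tau>(1) dd by simp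
    then have k: "real k \<le> (t + \<tau>) / d" "(t + \<tau>) / d < real k + 1" unfolding k_def by linarith+
    then have k': "real k * d \<le> t + \<tau>" "t + \<tau> < real k * d + d"
      using dd(1) by (auto simp: field_simps)
    have "real k * d < real n * d" using k' n \<tau>(1) by (simp only: atLeastAtMost_iff) linarith
    then have "k \<le> n" using dd(1) by (simp add: mult_less_cancel_right)
    then have "real k * d \<in> A" by (auto simp: A_def)
    moreover have "norm (F (x + t) - F (x + real k * d)) \<le> e" for x
    proof -
      have "norm (F (x + real k * d + (t + \<tau> - real k * d)) - F (x + real k * d)) \<le> 3 * (e/4)"
        using k' by (intro uc) auto
      moreover have "norm (F (x + t + \<tau>) - F (x + t)) \<le> e/4" by (rule \<tau>(2))
      ultimately show ?thesis
        using norm_triangle_ineq4[of "F (x + t + \<tau>) - F (x + real k * d)" "F (x + t + \<tau>) - F (x + t)"]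
        by (simp add: algebra_simps)
    qed
    ultimately show ?thesis by blast
  qed
  moreover have "finite A" by (simp add: A_def)
  ultimately show "\<exists>A. finite A \<and> (\<forall>t. \<exists>a\<in>A. \<forall>x. norm (F (x + t) - F (x + a)) \<le> e)" by blast
qed

text \<open>The two functions come with separate finite sets, and no element of one need serve the
  other. A pair \<open>(a, b)\<close> labels a class of translations and one member represents the
  class; halving the tolerance pays for comparing two members.\<close>

lemma ap_joint_translates:
  assumes "ap F" "ap G" "e > 0"
  obtains A where "finite A" "\<And>t. \<exists>a\<in>A. (\<forall>x. norm (F (x + t) - F (x + a)) \<le> e) \<and> (\<forall>x. norm (G (x + t) - G (x + a)) \<le> e)"
proof -
  obtain A where A: "finite A" "\<And>t. \<exists>a\<in>A. \<forall>x. norm (F (x + t) - F (x + a)) \<le> e/2"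
    using ap_finite_translates[OF assms(1), of "e/2"] assms(3) by auto
  obtain B where B: "finite B" "\<And>t. \<exists>a\<in>B. \<forall>x. norm (G (x + t) - G (x + a)) \<le> e/2"
    using ap_finite_translates[OF assms(2), of "e/2"] assms(3) by auto
  define P where "P a b t \<longleftrightarrow> (\<forall>x. norm (F (x + t) - F (x + a)) \<le> e/2) \<and> (\<forall>x. norm (G (x + t) - G (x + b)) \<le> e/2)" for a b t
  \<comment> \<open>For an empty class the choice is an arbitrary real number, which merely enlarges
    the finite set.\<close>
  define C where "C = (\<lambda>(a,b). SOME t. P a b t) ` (A \<times> B)"
  have "\<exists>c\<in>C. (\<forall>x. norm (F (x + t) - F (x + c)) \<le> e) \<and> (\<forall>x. norm (G (x + t) - G (x + c)) \<le> e)" for t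
  proof -
    obtain a b where ab: "a \<in> A" "b \<in> B" "P a b t" using A(2)[of t] B(2)[of t] unfolding P_def by blast
    define c where "c = (SOME t. P a b t)"
    have c: "P a b c" unfolding c_def using ab(3) by (rule someI)
    have "c \<in> C" unfolding C_def c_def using ab by force
    moreover have "norm (F (x + t) - F (x + c)) \<le> e" for x
      using c ab(3) norm_triangle_ineq4[of "F (x + t) - F (x + a)" "F (x + c) - F (x + a)"]
      unfolding P_def by (smt (verit) add_diff_cancel_right' diff_diff_eq2 field_sum_of_halves diff_add_cancel)
    moreover have "norm (G (x + t) - G (x + c)) \<le> e" for x
      using c ab(3) norm_triangle_ineq4[of "G (x + t) - G (x + b)" "G (x + c) - G (x + b)"]
      unfolding P_def by (smt (verit) add_diff_cancel_right' diff_diff_eq2 field_sum_of_halves diff_add_cancel)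
    ultimately show ?thesis by blast
  qed
  moreover have "finite C" unfolding C_def using A(1) B(1) by simp
  ultimately show ?thesis using that by blast
qed

lemma ap_add:
  assumes "ap F" "ap G" shows "ap (\<lambda>x. F x + G x)"
  unfolding ap_def
proof (intro conjI allI impI)
  show "continuous_on UNIV (\<lambda>x. F x + G x)" by (intro continuous_intros ap_continuous assms)
  fix e :: real assume "e > 0"
  obtain A where A: "finite A" "\<And>t. \<exists>a\<in>A. (\<forall>x. norm (F (x + t) - F (x + a)) \<le> e/2) \<and> (\<forall>x. norm (G (x + t) - G (x + a)) \<le> e/2)"
    using ap_joint_translates[OF assms, of "e/2"] \<open>e > 0\<close> by auto
  have "\<exists>a\<in>A. \<forall>x. norm (F (x + t) + G (x + t) - (F (x + a) + G (x + a))) \<le> e" for t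
  proof -
    obtain a where a: "a \<in> A" "\<And>x. norm (F (x + t) - F (x + a)) \<le> e/2" "\<And>x. norm (G (x + t) - G (x + a)) \<le> e/2"
      using A(2) by blast
    have "norm (F (x + t) + G (x + t) - (F (x + a) + G (x + a))) \<le> e" for x
      using norm_diff_triangle_ineq[of "F (x + t)" "G (x + t)" "F (x + a)" "G (x + a)"] a(2,3)[of x] by linarith
    with a show ?thesis by blast
  qed
  with A(1) show "\<exists>A. finite A \<and> (\<forall>t. \<exists>a\<in>A. \<forall>x. norm (F (x + t) + G (x + t) - (F (x + a) + G (x + a))) \<le> e)"
    by blast
qed

lemma ap_mult:
  assumes "ap F" "ap G" shows "ap (\<lambda>x. F x * G x)"
  unfolding ap_def
proof (intro conjI allI impI)
  show "continuous_on UNIV (\<lambda>x. F x * G x)" by (intro continuous_intros ap_continuous assms)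
  fix e :: real assume "e > 0"
  obtain B where B: "B > 0" "\<And>x. norm (F x) \<le> B" using ap_bounded[OF assms(1)] by blast
  obtain C where C: "C > 0" "\<And>x. norm (G x) \<le> C" using ap_bounded[OF assms(2)] by blast
  define r where "r = e / (B + C)"
  have r: "r > 0" "r * (B + C) = e" using \<open>e > 0\<close> B(1) C(1) by (auto simp: r_def)
  obtain A where A: "finite A" "\<And>t. \<exists>a\<in>A. (\<forall>x. norm (F (x + t) - F (x + a)) \<le> r) \<and> (\<forall>x. norm (G (x + t) - G (x + a)) \<le> r)"
    using ap_joint_translates[OF assms r(1)] by auto
  have "\<exists>a\<in>A. \<forall>x. norm (F (x + t) * G (x + t) - (F (x + a) * G (x + a))) \<le> e" for t
  proof -
    obtain a where a: "a \<in> A" "\<And>x. norm (F (x + t) - F (x + a)) \<le> r" "\<And>x. norm (G (x + t) - G (x + a)) \<le> r"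
      using A(2) by blast
    have "norm (F (x + t) * G (x + t) - (F (x + a) * G (x + a))) \<le> e" for x
    proof -
      have "F (x + t) * G (x + t) - (F (x + a) * G (x + a))
        = F (x + t) * (G (x + t) - G (x + a)) + (F (x + t) - F (x + a)) * G (x + a)" by (simp add: algebra_simps)
      also have "norm \<dots> \<le> norm (F (x + t)) * norm (G (x + t) - G (x + a)) + norm (F (x + t) - F (x + a)) * norm (G (x + a))"
        by (metis norm_mult norm_triangle_ineq)
      also have "\<dots> \<le> B * r + r * C"
        using a(2,3) B C r(1) by (intro add_mono mult_mono) auto
      finally show ?thesis using r(2) by (simp add: algebra_simps)
    qed
    with a show ?thesis by blast
  qed
  with A(1) show "\<exists>A. finite A \<and> (\<forall>t. \<exists>a\<in>A. \<forall>x. norm (F (x + t) * G (x + t) - F (x + a) * G (x + a)) \<le> e)"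
    by (intro exI[of _ A] conjI allI)
qed

lemma ap_const: "ap (\<lambda>x. c)"
  unfolding ap_def by (auto intro!: exI[of _ "{0}"])

lemma ap_exp: "ap (\<lambda>t. exp (\<i> * complex_of_real (\<mu> * t)))"
proof (rule ap_bohr)
  show "continuous_on UNIV (\<lambda>t. exp (\<i> * complex_of_real (\<mu> * t)))" by (intro continuous_intros)
  fix e :: real assume "e > 0"
  show "\<exists>l>0. \<forall>x. \<exists>\<tau>\<in>{x..x + l}. \<forall>t. norm (exp (\<i> * complex_of_real (\<mu> * (t + \<tau>))) - exp (\<i> * complex_of_real (\<mu> * t))) \<le> e"
  proof (cases "\<mu> = 0")
    case True with \<open>e > 0\<close> show ?thesis by (intro exI[of _ 1]) auto
  next
    case False
    define p where "p = 2 * pi / \<bar>\<mu>\<bar>"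
    have p: "p > 0" "\<bar>\<mu>\<bar> * p = 2 * pi" using False by (auto simp: p_def)
    have "\<exists>\<tau>\<in>{x..x + p}. \<forall>t. norm (exp (\<i> * complex_of_real (\<mu> * (t + \<tau>))) - exp (\<i> * complex_of_real (\<mu> * t))) \<le> e" for x
    proof -
      define k where "k = \<lceil>x / p\<rceil>"
      have k: "x / p \<le> k" "k < x / p + 1" unfolding k_def by linarith+
      have "k * p \<in> {x..x+p}" using k p(1) by (simp add: field_simps)
      moreover have "exp (\<i> * complex_of_real (\<mu> * (t + k * p))) = exp (\<i> * complex_of_real (\<mu> * t))" for t
      proof -
        obtain m :: int where m: "\<mu> * (k * p) = of_int m * (2 * pi)"
        proof (cases "\<mu> \<ge> 0")
          case True then show ?thesis using p(2) by (intro that[of k]) (simp add: algebra_simps)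
        next
          case False
          then have "\<mu> * p = - (2 * pi)" using p(2) by simp
          then have "\<mu> * p * k = of_int (-k) * (2 * pi)" by simp
          then have "\<mu> * (k * p) = of_int (-k) * (2 * pi)" by (simp add: mult_ac)
          then show ?thesis by (rule that)
        qed
        have "\<i> * complex_of_real (\<mu> * (t + k * p)) = \<i> * complex_of_real (\<mu> * t) + \<i> * (of_int m * (of_real pi * 2))"
          using m by (simp add: distrib_left flip: of_real_mult) (simp add: algebra_simps)
        then show ?thesis by (simp only: exp_plus_2pin[symmetric]) (simp add: exp_plus_2pin exp_integer_2pi exp_add algebra_simps)
      qed
      ultimately show ?thesis using \<open>e > 0\<close> by (intro bexI[of _ "k * p"]) auto
    qed
    with p(1) show ?thesis by blast
  qed
qed

lemma ap_uniform_limit: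
  assumes "\<And>n. ap (F n)" "uniform_limit UNIV F G sequentially"
  shows "ap G"
  unfolding ap_def
proof (intro conjI allI impI)
  show "continuous_on UNIV G"
    by (rule uniform_limit_theorem[OF _ assms(2)]) (auto intro!: always_eventually ap_continuous assms(1))
  fix e :: real assume "e > 0"
  then have "\<forall>\<^sub>F n in sequentially. \<forall>x\<in>UNIV. dist (F n x) (G x) < e/3"
    using assms(2) by (intro uniform_limitD) auto
  then obtain n where n: "\<And>x. dist (F n x) (G x) < e/3"
    by (auto simp: eventually_sequentially)
  obtain A where A: "finite A" "\<And>t. \<exists>a\<in>A. \<forall>x. norm (F n (x + t) - F n (x + a)) \<le> e/3"
    using ap_finite_translates[OF assms(1), of "e/3" n] \<open>e > 0\<close> by auto
  have "norm (G (x + t) - G (x + a)) \<le> e" if "norm (F n (x + t) - F n (x + a)) \<le> e/3" for x t a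
    using n[of "x+t"] n[of "x+a"] that dist_triangle2[of "G (x+t)" "G (x+a)" "F n (x+t)"]
      dist_triangle2[of "F n (x+t)" "G (x+a)" "F n (x+a)"] by (simp add: dist_norm norm_minus_commute)
  then show "\<exists>A. finite A \<and> (\<forall>t. \<exists>a\<in>A. \<forall>x. norm (G (x + t) - G (x + a)) \<le> e)"
    using A by meson
qed

section \<open>Mean values of almost periodic functions\<close>

lemma continuous_integrable:
  fixes G :: "real \<Rightarrow> 'a::banach"
  assumes "continuous_on UNIV G" shows "G integrable_on {a..b}"
  using assms by (intro integrable_continuous_real) (auto intro: continuous_on_subset)

lemma integral_translate_le:
  fixes G :: "real \<Rightarrow> complex"
  assumes "continuous_on UNIV G" "\<And>x. norm (G x) \<le> B" "c \<le> d"
  shows "norm (integral {c + a..d + a} G - integral {c..d} G) \<le> 2 * B * \<bar>a\<bar>"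
proof -
  have *: "norm (integral {c + a..d + a} G - integral {c..d} G) \<le> 2 * B * \<bar>a\<bar>" if "a \<ge> 0" "c \<le> d" for a c d
  proof -
    have 1: "integral {c..c+a} G + integral {c+a..d+a} G = integral {c..d+a} G"
      using that assms(1) by (intro Henstock_Kurzweil_Integration.integral_combine continuous_integrable) auto
    have 2: "integral {c..d} G + integral {d..d+a} G = integral {c..d+a} G"
      using that assms(1) by (intro Henstock_Kurzweil_Integration.integral_combine continuous_integrable) auto
    have 3: "norm (integral {c..c+a} G) \<le> B * (c + a - c)" "norm (integral {d..d+a} G) \<le> B * (d + a - d)"
      by (rule integral_bound; use that assms in \<open>auto intro: continuous_on_subset\<close>)+
    have "integral {c + a..d + a} G - integral {c..d} G = integral {d..d+a} G - integral {c..c+a} G"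
      using 1 2 by (simp add: algebra_simps) 
    then show ?thesis using 3 norm_triangle_ineq4[of "integral {d..d+a} G" "integral {c..c+a} G"] that by simp
  qed
  show ?thesis
  proof (cases "a \<ge> 0")
    case True with *[of a c d] assms(3) show ?thesis by blast
  next
    case False
    then show ?thesis using *[of "-a" "c+a" "d+a"] assms(3) by (simp add: norm_minus_commute)
  qed
qed

text \<open>The point is uniformity in the centre \<open>x\<close>: up to \<open>e/4\<close> the
  window around \<open>x\<close> sees the same values as the window around some \<open>a\<close>
  from a fixed finite set, and a shift by such an \<open>a\<close> changes the integral by a bounded
  amount, negligible against \<open>T\<close>.\<close>

lemma ap_window:
  assumes "ap G" "e > 0"
  obtains T0 where "T0 > 0" "\<And>T x. T \<ge> T0 \<Longrightarrow> norm (integral {x-T..x+T} G - integral {-T..T} G) \<le> e * T"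
proof -
  obtain B where B: "B > 0" "\<And>x. norm (G x) \<le> B" using ap_bounded[OF assms(1)] by blast
  obtain A where A: "finite A" "\<And>t. \<exists>a\<in>A. \<forall>x. norm (G (x + t) - G (x + a)) \<le> e/4"
    using ap_finite_translates[OF assms(1), of "e/4"] assms(2) by auto
  define K where "K = (\<Sum>a\<in>A. \<bar>a\<bar>)"
  \<comment> \<open>Beyond \<open>T0\<close> the shift cost \<open>2 * B * K\<close> is at most
    \<open>e/2 * T\<close>; the summand 1 keeps \<open>T0\<close> positive.\<close>
  define T0 where "T0 = 1 + 4 * B * K / e"
  have K0: "K \<ge> 0" unfolding K_def by (simp add: sum_nonneg)
  have T0: "T0 > 0" unfolding T0_def using B assms(2) K0 by (simp add: add_pos_nonneg)
  have "norm (integral {x-T..x+T} G - integral {-T..T} G) \<le> e * T" if "T \<ge> T0" for T x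
  proof -
    have Tp: "T > 0" using that T0 by linarith
    obtain a where a: "a \<in> A" "\<And>s. norm (G (s + x) - G (s + a)) \<le> e/4" using A(2) by blast
    have aK: "\<bar>a\<bar> \<le> K" unfolding K_def using a(1) A(1) by (intro member_le_sum) auto
    have c: "continuous_on S (\<lambda>s. G (s + y))" for S y
      using assms(1) by (intro continuous_on_compose2[OF ap_continuous[OF assms(1), of UNIV]] continuous_intros) auto
    have sh: "integral {y-T..y+T} G = integral {-T..T} (\<lambda>s. G (s + y))" for y
      using integral_shift_Icc_real[of "-T" T G y] by (simp add: o_def add.commute)
    have "integral {x-T..x+T} G - integral {a-T..a+T} G = integral {-T..T} (\<lambda>s. G (s + x) - G (s + a))"
      unfolding sh by (subst integral_diff) (auto intro: continuous_integrable c)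
    also have "norm \<dots> \<le> e/4 * (T - (-T))"
      using a(2) Tp by (intro integral_bound) (auto intro!: continuous_on_diff c)
    finally have 1: "norm (integral {x-T..x+T} G - integral {a-T..a+T} G) \<le> e/2 * T" by (simp add: algebra_simps)
    have "norm (integral {a-T..a+T} G - integral {-T..T} G) \<le> 2 * B * \<bar>a\<bar>"
      using integral_translate_le[OF ap_continuous[OF assms(1)] B(2), of "-T" T a] Tp by (simp add: add.commute)
    also have "\<dots> \<le> 2 * B * K" using aK B(1) by simp
    also have "\<dots> \<le> e/2 * T"
      using that assms(2) unfolding T0_def by (simp add: field_simps)
    finally show ?thesis
      using 1 norm_triangle_ineq[of "integral {x-T..x+T} G - integral {a-T..a+T} G" "integral {a-T..a+T} G - integral {-T..T} G"]
      by (simp add: field_simps)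
  qed
  then show ?thesis using that T0 by blast
qed

text \<open>Averaging the means over windows centred in \<open>{-S..S}\<close> and exchanging the integrals compares
  the mean over \<open>{-T..T}\<close> with the mean over \<open>{-S..S}\<close>.\<close>

lemma ap_mean_cauchy:
  assumes "ap G" "e > 0"
  obtains T0 where "T0 > 0" "\<And>S T. S \<ge> T0 \<Longrightarrow> T \<ge> T0 \<Longrightarrow>
     norm (complex_of_real (1/(2*T)) * integral {-T..T} G - complex_of_real (1/(2*S)) * integral {-S..S} G) \<le> e"
proof -
  obtain T0 where T0: "T0 > 0" "\<And>T x. T \<ge> T0 \<Longrightarrow> norm (integral {x-T..x+T} G - integral {-T..T} G) \<le> e * T"
    using ap_window[OF assms] by blast
  have c: "continuous_on UNIV (\<lambda>s. G (s + y))" "continuous_on UNIV (\<lambda>s. G (y + s))" for y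
    using assms(1) by (auto intro!: continuous_on_compose2[OF ap_continuous[OF assms(1), of UNIV]] continuous_intros)
  have sh: "integral {y-T..y+T} G = integral {-T..T} (\<lambda>s. G (y + s))" for y T
    using integral_shift_Icc_real[of "-T" T G y] by (simp add: o_def add.commute)
  have c2: "continuous_on (cbox (a,b) (c,d)) (\<lambda>(x,y). G (x + y))" for a b c d :: real
    unfolding case_prod_beta
    by (intro continuous_on_compose2[OF ap_continuous[OF assms(1), of UNIV]] continuous_intros) auto
  have cI: "continuous_on {a..b} (\<lambda>x. integral {-T..T} (\<lambda>s. G (x + s)))" for a b T
    using integral_continuous_on_param[of "{a..b}" "-T" T "\<lambda>x s. G (x + s)"] c2[of a "-T" b T]
    by (simp add: cbox_Pair_eq case_prod_unfold)
  have *: "norm (integral {-S..S} (\<lambda>x. integral {-T..T} (\<lambda>s. G (x + s))) - complex_of_real (2 * S) * integral {-T..T} G) \<le> e * T * (2 * S)"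
    if "S \<ge> T0" "T \<ge> T0" for S T
  proof -
    have "integral {-S..S} (\<lambda>x. integral {-T..T} (\<lambda>s. G (x + s))) - complex_of_real (2 * S) * integral {-T..T} G
      = integral {-S..S} (\<lambda>x. integral {-T..T} (\<lambda>s. G (x + s)) - integral {-T..T} G)"
      using that T0(1) by (subst integral_diff) (auto intro!: integrable_continuous_real cI simp: scaleR_conv_of_real)
    also have "norm \<dots> \<le> e * T * (S - (-S))"
      using that T0 by (intro integral_bound continuous_intros cI) (auto simp flip: sh)
    finally show ?thesis by simp
  qed
  have "norm (complex_of_real (1/(2*T)) * integral {-T..T} G - complex_of_real (1/(2*S)) * integral {-S..S} G) \<le> e"
    if "S \<ge> T0" "T \<ge> T0" for S T
  proof -
    have p: "S > 0" "T > 0" using that T0 by linarith+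
    define D where "D = integral {-S..S} (\<lambda>x. integral {-T..T} (\<lambda>s. G (x + s)))"
    have D2: "D = integral {-T..T} (\<lambda>x. integral {-S..S} (\<lambda>s. G (x + s)))"
      unfolding D_def using integral_swap_continuous[of "-S" "-T" S T "\<lambda>x y. G (x + y)", OF c2] by (simp add: add.commute)
    have 1: "norm (D - complex_of_real (2 * S) * integral {-T..T} G) \<le> e * T * (2 * S)"
      unfolding D_def using * that by blast
    have 2: "norm (D - complex_of_real (2 * T) * integral {-S..S} G) \<le> e * S * (2 * T)"
      unfolding D2 using * that by blast
    have "norm (complex_of_real (2 * S) * integral {-T..T} G - complex_of_real (2 * T) * integral {-S..S} G) \<le> e * (4 * S * T)"
      using 1 2 norm_triangle_ineq4[of "D - complex_of_real (2 * T) * integral {-S..S} G" "D - complex_of_real (2 * S) * integral {-T..T} G"] 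
      by (simp add: algebra_simps)
    moreover have "complex_of_real (1/(2*T)) * integral {-T..T} G - complex_of_real (1/(2*S)) * integral {-S..S} G
      = complex_of_real (1 / (4 * S * T)) * (complex_of_real (2 * S) * integral {-T..T} G - complex_of_real (2 * T) * integral {-S..S} G)"
      using p by (simp add: field_simps)
    ultimately have "norm (complex_of_real (1/(2*T)) * integral {-T..T} G - complex_of_real (1/(2*S)) * integral {-S..S} G)
      \<le> 1 / (4 * S * T) * (e * (4 * S * T))"
      using p by (simp only: norm_mult norm_of_real) (intro mult_mono, auto)
    also have "\<dots> = e" using p by simp
    finally show ?thesis .
  qed
  with T0(1) show ?thesis using that by blast
qed

lemma ap_has_mean:
  assumes "ap G" obtains L where "has_mean G L"
proof -
  define m where "m T = complex_of_real (1/(2*T)) * integral {-T..T} G" for T :: real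
  have cau: "\<exists>T0>0. \<forall>S\<ge>T0. \<forall>T\<ge>T0. norm (m T - m S) \<le> e" if "e > 0" for e
    unfolding m_def by (rule ap_mean_cauchy[OF assms that]) blast
  have "cauchy_filter (filtermap m at_top)"
    unfolding cauchy_filter_metric_filtermap
  proof (intro allI impI)
    fix e :: real assume "e > 0"
    then obtain T0 where "\<forall>S\<ge>T0. \<forall>T\<ge>T0. norm (m T - m S) \<le> e/2" using cau[of "e/2"] by auto
    with \<open>e > 0\<close> have "\<And>S T. T \<ge> T0 \<and> S \<ge> T0 \<longrightarrow> dist (m T) (m S) < e"
      by (metis dist_norm field_sum_of_halves less_add_same_cancel1 half_gt_zero le_less_trans)
    then show "\<exists>P. eventually P at_top \<and> (\<forall>x y. P x \<and> P y \<longrightarrow> dist (m x) (m y) < e)"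
      by (intro exI[of _ "\<lambda>T. T \<ge> T0"]) (auto simp: eventually_ge_at_top)
  qed
  then obtain L where "(m \<longlongrightarrow> L) at_top"
    using cauchy_filter_convergent[of "filtermap m at_top"]
    by (auto simp: convergent_filter_iff filterlim_def)
  then show ?thesis using that unfolding has_mean_def m_def by blast
qed

section \<open>Uniqueness\<close>

lemma sum_cis_roots:
  fixes r :: int and M :: nat
  assumes "M > 0" "\<bar>r\<bar> < int M"
  shows "(\<Sum>j<M. cis (2 * pi * real j / real M * of_int r)) = (if r = 0 then of_nat M else 0)"
proof (cases "r = 0")
  case False
  define z where "z = cis (2 * pi * of_int r / real M)"
  have "cis (2 * pi * real j / real M * of_int r) = z ^ j" for j
    by (simp only: z_def Complex.DeMoivre) (intro arg_cong[of _ _ cis], simp)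
  then have "(\<Sum>j<M. cis (2 * pi * real j / real M * of_int r)) = (\<Sum>j<M. z ^ j)" by simp
  also have "\<dots> = 0"
  proof -
    have "z ^ M = 1"
      using assms(1) by (simp add: z_def Complex.DeMoivre)
    moreover have "z \<noteq> 1"
    proof
      assume "z = 1"
      then obtain n :: int where "2 * pi * of_int r / real M = of_int (2 * n) * pi"
        unfolding z_def cis_conv_exp exp_eq_1 by auto
      then have "real_of_int r = of_int (n * int M)" using assms(1) by (simp add: field_simps)
      then have "r = n * int M" by (simp only: of_int_eq_iff)
      then have "\<bar>n\<bar> * int M < 1 * int M" "n \<noteq> 0" using assms False by (auto simp: abs_mult)
      then show False by (simp only: mult_less_cancel_right) auto
    qed
    ultimately show ?thesis by (simp add: geometric_sum)
  qed
  finally show ?thesis using False by simp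
qed auto

lemma dft_parseval:
  fixes v :: "nat \<Rightarrow> complex"
  assumes "M > 0"
  shows "(\<Sum>j<M. (norm (\<Sum>k<M. v k * cis (- (2 * pi * real j / real M * real k))))\<^sup>2) = real M * (\<Sum>k<M. (norm (v k))\<^sup>2)"
proof -
  define w where "w j k = cis (- (2 * pi * real j / real M * real k))" for j k
  have ww: "(\<Sum>j<M. w j k * cnj (w j l)) = (if l = k then of_nat M else 0)" if "k < M" "l < M" for k l
  proof -
    have "w j k * cnj (w j l) = cis (2 * pi * real j / real M * of_int (int l - int k))" for j
      unfolding w_def cis_cnj cis_mult by (intro arg_cong[of _ _ cis]) (simp add: algebra_simps diff_divide_distrib)
    then show ?thesis using sum_cis_roots[OF assms, of "int l - int k"] that by auto
  qed
  have "complex_of_real (\<Sum>j<M. (norm (\<Sum>k<M. v k * w j k))\<^sup>2) = (\<Sum>j<M. (\<Sum>k<M. v k * w j k) * cnj (\<Sum>k<M. v k * w j k))"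
    by (simp only: of_real_sum complex_norm_square)
  also have "\<dots> = (\<Sum>j<M. \<Sum>k<M. \<Sum>l<M. v k * cnj (v l) * (w j k * cnj (w j l)))"
    by (simp add: sum_product mult_ac)
  also have "\<dots> = (\<Sum>k<M. \<Sum>l<M. \<Sum>j<M. v k * cnj (v l) * (w j k * cnj (w j l)))"
    by (subst sum.swap, rule sum.cong[OF refl], rule sum.swap)
  also have "\<dots> = (\<Sum>k<M. \<Sum>l<M. v k * cnj (v l) * (if l = k then of_nat M else 0))"
    by (intro sum.cong refl) (simp add: ww flip: sum_distrib_left)
  also have "\<dots> = (\<Sum>k<M. v k * cnj (v k) * of_nat M)"
    by (intro sum.cong refl) (simp add: if_distrib[of "\<lambda>x. _ * x"] sum.delta cong: if_cong)
  also have "\<dots> = complex_of_real (real M * (\<Sum>k<M. (norm (v k))\<^sup>2))"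
    by (simp add: complex_norm_square sum_distrib_left mult_ac del: of_real_power)
  finally show ?thesis unfolding w_def of_real_eq_iff .
qed

text \<open>Parseval's identity modulo \<open>2 * L\<close>, applied to the zero-padded \<open>u\<close> and again to its
  autocorrelation, whose transform is the squared modulus of that of \<open>u\<close>.\<close>

lemma autocorrelation_bound:
  fixes u :: "nat \<Rightarrow> complex"
  assumes "L > 0" and E: "\<And>\<theta>. norm (\<Sum>k<L. u k * cis (- (\<theta> * real k))) \<le> E"
  shows "(\<Sum>m<L. (norm (\<Sum>l<L - m. u (l + m) * cnj (u l)))\<^sup>2) \<le> E\<^sup>2 * (\<Sum>k<L. (norm (u k))\<^sup>2)"
proof -
  \<comment> \<open>Lags \<open>k - l\<close> lie strictly between \<open>-L\<close> and
    \<open>L\<close>, so modulo \<open>2 * L\<close> they do not wrap around.\<close>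
  define M where "M = 2 * L"
  define w where "w j = 2 * pi * real j / real M" for j
  define U where "U j = (\<Sum>k<L. u k * cis (- (w j * real k)))" for j
  \<comment> \<open>The index is the lag plus \<open>L\<close>, which keeps it a natural number; the
    transform changes only by the unimodular factor \<open>cis (- (w j * real L))\<close>.\<close>
  define g where "g m = (\<Sum>(k,l) | k < L \<and> l < L \<and> k + L - l = m. u k * cnj (u l))" for m
  have M: "M > 0" using assms(1) by (simp add: M_def)
  have V: "(\<Sum>m<M. g m * cis (- (w j * real m))) = U j * cnj (U j) * cis (- (w j * real L))" for j
  proof -
    have "U j * cnj (U j) * cis (- (w j * real L)) = (\<Sum>k<L. \<Sum>l<L. u k * cnj (u l) * cis (- (w j * real (k + L - l))))"
      unfolding U_def cnj_sum sum_product unfolding sum_distrib_right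
    proof (intro sum.cong refl)
      fix k l assume "k \<in> {..<L}" "l \<in> {..<L}"
      then have *: "cis (- (w j * real (k + L - l))) = cis (- (w j * real k)) * cnj (cis (- (w j * real l))) * cis (- (w j * real L))"
        unfolding cis_cnj cis_mult by (intro arg_cong[of _ _ cis]) (simp add: of_nat_diff algebra_simps)
      show "u k * cis (- (w j * real k)) * cnj (u l * cis (- (w j * real l))) * cis (- (w j * real L)) =
        u k * cnj (u l) * cis (- (w j * real (k + L - l)))" unfolding * by simp
    qed
    also have "\<dots> = (\<Sum>(k,l)\<in>{..<L}\<times>{..<L}. u k * cnj (u l) * cis (- (w j * real (k + L - l))))"
      by (simp only: sum.cartesian_product)
    also have "\<dots> = (\<Sum>m<M. \<Sum>p | p \<in> {..<L}\<times>{..<L} \<and> (\<lambda>(k,l). k + L - l) p = m.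
        (\<lambda>(k,l). u k * cnj (u l) * cis (- (w j * real (k + L - l)))) p)"
      by (rule sum.group[symmetric]) (auto simp: M_def)
    also have "\<dots> = (\<Sum>m<M. g m * cis (- (w j * real m)))"
      unfolding g_def sum_distrib_right by (intro sum.cong refl) (auto simp: case_prod_beta)
    finally show ?thesis by simp
  qed
  have P1: "(\<Sum>j<M. (norm (U j))\<^sup>2) = real M * (\<Sum>k<L. (norm (u k))\<^sup>2)"
  proof -
    define v where "v k = (if k < L then u k else 0)" for k
    have "(\<Sum>k<M. v k * cis (- (w j * real k))) = U j" for j
      unfolding U_def by (rule sum.mono_neutral_cong_right) (auto simp: v_def M_def)
    moreover have "(\<Sum>k<M. (norm (v k))\<^sup>2) = (\<Sum>k<L. (norm (u k))\<^sup>2)"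
      by (rule sum.mono_neutral_cong_right) (auto simp: v_def M_def)
    ultimately show ?thesis using dft_parseval[OF M, of v] unfolding w_def by simp
  qed
  have P2: "(\<Sum>j<M. ((norm (U j))\<^sup>2)\<^sup>2) = real M * (\<Sum>m<M. (norm (g m))\<^sup>2)"
    using dft_parseval[OF M, of g] V unfolding w_def by (simp add: norm_mult power2_eq_square)
  have gL: "g (L + m) = (\<Sum>l<L - m. u (l + m) * cnj (u l))" if "m < L" for m
  proof -
    have "bij_betw (\<lambda>l. (l + m, l)) {..<L - m} {(k,l). k < L \<and> l < L \<and> k + L - l = L + m}"
      by (rule bij_betwI[of _ _ _ snd]) auto
    from sum.reindex_bij_betw[OF this, of "\<lambda>(k,l). u k * cnj (u l)"] show ?thesis
      unfolding g_def by (simp add: case_prod_beta)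
  qed
  \<comment> \<open>Only the nonnegative lags, the indices from \<open>L\<close> on, are
    kept.\<close>
  have "real M * (\<Sum>m<L. (norm (\<Sum>l<L - m. u (l + m) * cnj (u l)))\<^sup>2) = real M * (\<Sum>m<L. (norm (g (L + m)))\<^sup>2)"
    by (simp add: gL)
  also have "(\<Sum>m<L. (norm (g (L + m)))\<^sup>2) = (\<Sum>m\<in>(+) L ` {..<L}. (norm (g m))\<^sup>2)"
    by (subst sum.reindex) auto
  also have "real M * \<dots> \<le> real M * (\<Sum>m<M. (norm (g m))\<^sup>2)"
    by (intro mult_left_mono sum_mono2) (auto simp: M_def)
  also have "\<dots> = (\<Sum>j<M. ((norm (U j))\<^sup>2)\<^sup>2)" by (simp only: P2)
  \<comment> \<open>One factor \<open>(norm (U j))\<^sup>2\<close> is bounded by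
    \<open>E\<^sup>2\<close>; the other is kept and summed by \<open>P1\<close>.\<close>
  also have "\<dots> \<le> (\<Sum>j<M. E\<^sup>2 * (norm (U j))\<^sup>2)"
    unfolding power2_eq_square[of "(norm _)\<^sup>2"]
    by (intro sum_mono mult_right_mono power_mono) (auto simp: U_def E)
  also have "\<dots> = real M * (E\<^sup>2 * (\<Sum>k<L. (norm (u k))\<^sup>2))"
    by (simp add: P1 flip: sum_distrib_left)
  finally show ?thesis using M by simp
qed

section \<open>Sampling: from vanishing means to uniqueness\<close>

lemma ap_cis: "ap (\<lambda>t. cis (\<mu> * t))"
  using ap_exp[of \<mu>] by (simp add: cis_conv_exp)

text \<open>A vanishing mean controls only windows centred at 0; \<open>ap_window\<close> transfers
  the bound to every centre.\<close>

lemma mean_zero_window: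
  assumes "ap G" "has_mean G 0" "e > 0"
  obtains T0 where "T0 > 0" "\<And>T x. T \<ge> T0 \<Longrightarrow> norm (integral {x-T..x+T} G) \<le> e * T"
proof -
  obtain T1 where T1: "T1 > 0" "\<And>T x. T \<ge> T1 \<Longrightarrow> norm (integral {x-T..x+T} G - integral {-T..T} G) \<le> e/2 * T"
    using ap_window[OF assms(1), of "e/2"] assms(3) by auto
  have "\<forall>\<^sub>F T in at_top. dist (complex_of_real (1 / (2 * T)) * integral {-T..T} G) 0 < e/4"
    using assms(2,3) unfolding has_mean_def by (intro tendstoD) auto
  then obtain T2 where T2: "\<And>T. T \<ge> T2 \<Longrightarrow> norm (complex_of_real (1 / (2 * T)) * integral {-T..T} G) < e/4"
    unfolding eventually_at_top_linorder by auto
  have "norm (integral {x-T..x+T} G) \<le> e * T" if "T \<ge> max T1 T2" for T x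
  proof -
    have "T > 0" using that T1 by simp
    then have "norm (integral {-T..T} G) \<le> e/2 * T"
      using T2[of T] that by (simp add: norm_mult norm_divide field_simps)
    then show ?thesis
      using T1(2)[of T x] that norm_triangle_ineq[of "integral {x-T..x+T} G - integral {-T..T} G" "integral {-T..T} G"]
      by (simp add: algebra_simps)
  qed
  then show ?thesis using that[of "max T1 T2"] T1(1) by simp
qed


text \<open>Across an interval of length \<open>d\<close> the phase turns by at most
  \<open>pi\<close>, so there is little cancellation: \<open>cos y \<ge> 1 - y\<^sup>2 / 2\<close>
  integrates to \<open>d * (1 - \<theta>\<^sup>2 / 24)\<close>, and
  \<open>pi\<^sup>2 \<le> 12\<close>. This is what allows a sum over samples to be bounded by an
  integral.\<close>

lemma cos_average_lower_bound:
  assumes "d > 0" "\<bar>\<theta>\<bar> \<le> pi"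
  shows "norm (integral {-(d/2)..d/2} (\<lambda>z. cis (- (\<theta> / d * z)))) \<ge> d / 2"
proof -
  define a where "a = \<theta> / d"
  have int: "(\<lambda>z. cis (- (a * z))) integrable_on {-(d/2)..d/2}"
    by (intro integrable_continuous_real continuous_intros)
  have "((\<lambda>z. 1 - (a * z)\<^sup>2 / 2) has_integral ((d/2 - a\<^sup>2 * (d/2)^3 / 6) - (-(d/2) - a\<^sup>2 * (-(d/2))^3 / 6))) {-(d/2)..d/2}"
  proof (rule fundamental_theorem_of_calculus)
    fix x :: real
    have "((\<lambda>z. z - a\<^sup>2 * z^3 / 6) has_real_derivative (1 - a\<^sup>2 * (3 * x\<^sup>2) / 6)) (at x within {-(d/2)..d/2})"
      by (auto intro!: derivative_eq_intros simp: power2_eq_square)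
    then show "((\<lambda>z. z - a\<^sup>2 * z^3 / 6) has_vector_derivative (1 - (a * x)\<^sup>2 / 2)) (at x within {-(d/2)..d/2})"
      by (simp add: has_real_derivative_iff_has_vector_derivative power_mult_distrib)
  qed (use assms in simp)
  moreover have "(d/2 - a\<^sup>2 * (d/2)^3 / 6) - (-(d/2) - a\<^sup>2 * (-(d/2))^3 / 6) = d * (1 - \<theta>\<^sup>2 / 24)"
    using assms(1) unfolding a_def by (simp add: field_simps power2_eq_square power3_eq_cube)
  ultimately have I: "((\<lambda>z. 1 - (a * z)\<^sup>2 / 2) has_integral d * (1 - \<theta>\<^sup>2 / 24)) {-(d/2)..d/2}" by simp
  have "\<theta>\<^sup>2 \<le> pi\<^sup>2" using assms(2) by (metis abs_le_square_iff abs_of_pos pi_gt_zero)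
  also have "pi\<^sup>2 \<le> 12" using power_mono[of pi "3.2" 2] pi_approx by (simp add: power2_eq_square)
  finally have "d / 2 \<le> d * (1 - \<theta>\<^sup>2 / 24)" using assms(1) by (simp add: field_simps)
  also have "\<dots> \<le> integral {-(d/2)..d/2} (\<lambda>z. Re (cis (- (a * z))))"
  proof (rule has_integral_le[OF I integrable_integral])
    show "(\<lambda>z. Re (cis (- (a * z)))) integrable_on {-(d/2)..d/2}"
      by (intro integrable_continuous_real continuous_intros)
    fix x :: real
    have "cos (a * x) = 1 - 2 * (sin (a * x / 2))\<^sup>2" using cos_double_sin[of "a * x / 2"] by simp
    moreover have "(sin (a * x / 2))\<^sup>2 \<le> (a * x / 2)\<^sup>2"
      using abs_sin_x_le_abs_x[of "a * x / 2"] by (simp only: abs_le_square_iff)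
    ultimately show "1 - (a * x)\<^sup>2 / 2 \<le> Re (cis (- (a * x)))"
      by (simp add: power2_eq_square)
  qed
  also have "\<dots> = Re (integral {-(d/2)..d/2} (\<lambda>z. cis (- (a * z))))"
    using has_integral_Re[OF integrable_integral[OF int]] by (simp add: integral_unique)
  also have "\<dots> \<le> norm (integral {-(d/2)..d/2} (\<lambda>z. cis (- (a * z))))"
    by (rule complex_Re_le_cmod)
  finally show ?thesis unfolding a_def .
qed

lemma sum_integral_blocks:
  fixes G :: "real \<Rightarrow> complex"
  assumes "continuous_on UNIV G" "d > 0"
  shows "(\<Sum>k<n. integral {x + real k * d - d/2..x + real k * d + d/2} G) = integral {x - d/2..x - d/2 + real n * d} G"
proof (induction n)
  case (Suc n)
  have "integral {x - d/2..x - d/2 + real n * d} G + integral {x - d/2 + real n * d..x - d/2 + real (Suc n) * d} G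
     = integral {x - d/2..x - d/2 + real (Suc n) * d} G"
    using assms by (intro Henstock_Kurzweil_Integration.integral_combine continuous_integrable) (auto simp: algebra_simps)
  with Suc show ?case by (simp add: algebra_simps)
qed auto

text \<open>On the cell of length \<open>d\<close> around the \<open>k\<close>-th sample,
  \<open>h\<close> is replaced by its sample at cost \<open>\<eta> * d\<close>; the remaining
  integral is \<open>cis (- (\<theta> * real k))\<close> times a constant of modulus at least
  \<open>d / 2\<close>. Summing over the cells ties the discrete frequency \<open>\<theta>\<close>
  to the continuous frequency \<open>\<theta> / d\<close>.\<close>

lemma sampled_sum_le_integral:
  fixes h :: "real \<Rightarrow> complex"
  assumes cont: "continuous_on UNIV h" and "d > 0" "\<bar>\<theta>\<bar> \<le> pi"
    and osc: "\<And>x y. \<bar>x - y\<bar> \<le> d / 2 \<Longrightarrow> norm (h x - h y) \<le> \<eta>"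
  shows "d / 2 * norm (\<Sum>k<n. h (x + real k * d) * cis (- (\<theta> * real k)))
     \<le> norm (integral {x - d/2..x - d/2 + real n * d} (\<lambda>t. h t * cis (- (\<theta> / d * t)))) + \<eta> * d * real n"
proof -
  define \<kappa> where "\<kappa> = integral {-(d/2)..d/2} (\<lambda>z. cis (- (\<theta> / d * z)))"
  \<comment> \<open>The phase is measured from \<open>x\<close>, so that the \<open>k\<close>-th
    cell gives exactly \<open>cis (- (\<theta> * real k))\<close>; the unimodular constant this
    introduces drops out of the norm at the end.\<close>
  define G where "G t = h t * cis (- (\<theta> / d * (t - x)))" for t
  define y where "y k = x + real k * d" for k
  have contG: "continuous_on S G" for S
    unfolding G_def by (intro continuous_intros continuous_on_subset[OF cont]) auto
  have blk: "norm (h (y k) * cis (- (\<theta> * real k)) * \<kappa> - integral {y k - d/2..y k + d/2} G) \<le> \<eta> * d" for k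
  proof -
    have "integral {y k - d/2..y k + d/2} (\<lambda>t. cis (- (\<theta> / d * (t - x)))) = integral {-(d/2)..d/2} ((\<lambda>t. cis (- (\<theta> / d * (t - x)))) \<circ> (+) (y k))"
      by (simp add: integral_shift_Icc_real add.commute)
    also have "((\<lambda>t. cis (- (\<theta> / d * (t - x)))) \<circ> (+) (y k)) = (\<lambda>z. cis (- (\<theta> * real k)) * cis (- (\<theta> / d * z)))"
      using assms(2) unfolding cis_mult y_def o_def by (intro ext arg_cong[of _ _ cis]) (simp add: field_simps)
    finally have "integral {y k - d/2..y k + d/2} (\<lambda>t. cis (- (\<theta> / d * (t - x)))) = cis (- (\<theta> * real k)) * \<kappa>"
      unfolding \<kappa>_def by simp
    then have "h (y k) * cis (- (\<theta> * real k)) * \<kappa> - integral {y k - d/2..y k + d/2} G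
      = integral {y k - d/2..y k + d/2} (\<lambda>t. h (y k) * cis (- (\<theta> / d * (t - x)))) - integral {y k - d/2..y k + d/2} G"
      by simp
    also have "\<dots> = integral {y k - d/2..y k + d/2} (\<lambda>t. h (y k) * cis (- (\<theta> / d * (t - x))) - G t)"
      by (rule integral_diff[symmetric]) (intro integrable_continuous_real continuous_intros contG)+
    also have "norm \<dots> \<le> \<eta> * (y k + d/2 - (y k - d/2))"
    proof (rule integral_bound)
      fix t assume "t \<in> {y k - d/2..y k + d/2}"
      then have "norm (h (y k) - h t) \<le> \<eta>" by (intro osc) (auto simp: abs_if)
      moreover have "h (y k) * cis (- (\<theta> / d * (t - x))) - G t = (h (y k) - h t) * cis (- (\<theta> / d * (t - x)))"
        unfolding G_def by (simp add: algebra_simps)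
      ultimately show "norm (h (y k) * cis (- (\<theta> / d * (t - x))) - G t) \<le> \<eta>" by (simp add: norm_mult)
    qed (use assms(2) in \<open>auto intro!: continuous_intros contG\<close>)
    finally show ?thesis by simp
  qed
  have "d / 2 * norm (\<Sum>k<n. h (y k) * cis (- (\<theta> * real k))) \<le> norm \<kappa> * norm (\<Sum>k<n. h (y k) * cis (- (\<theta> * real k)))"
    unfolding \<kappa>_def by (intro mult_right_mono cos_average_lower_bound assms) auto
  also have "\<dots> = norm (\<Sum>k<n. h (y k) * cis (- (\<theta> * real k)) * \<kappa>)"
    by (subst sum_distrib_right[symmetric]) (simp only: norm_mult mult.commute)
  also have "(\<Sum>k<n. h (y k) * cis (- (\<theta> * real k)) * \<kappa>) =
     (\<Sum>k<n. integral {y k - d/2..y k + d/2} G) + (\<Sum>k<n. h (y k) * cis (- (\<theta> * real k)) * \<kappa> - integral {y k - d/2..y k + d/2} G)"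
    by (simp add: sum_subtractf)
  also have "norm \<dots> \<le> norm (\<Sum>k<n. integral {y k - d/2..y k + d/2} G) + (\<Sum>k<n. \<eta> * d)"
    by (intro order.trans[OF norm_triangle_ineq] add_left_mono order.trans[OF norm_sum] sum_mono blk)
  also have "(\<Sum>k<n. integral {y k - d/2..y k + d/2} G) = integral {x - d/2..x - d/2 + real n * d} G"
    unfolding y_def by (rule sum_integral_blocks[OF contG assms(2)])
  also have "G = (\<lambda>t. cis (\<theta> / d * x) * (h t * cis (- (\<theta> / d * t))))"
    unfolding G_def by (intro ext) (simp add: cis_mult algebra_simps diff_divide_distrib)
  finally show ?thesis
    by (simp only: y_def integral_mult_right norm_mult norm_cis mult_1 sum_constant card_lessThan mult.commute[of "real n"])
qed

lemma sum_lessThan_add: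
  fixes f :: "nat \<Rightarrow> 'a::comm_monoid_add"
  shows "(\<Sum>k<m + n. f k) = (\<Sum>k<m. f k) + (\<Sum>k<n. f (k + m))"
  by (induction n) (simp_all add: add.assoc add.commute[of m])

text \<open>Moving on by \<open>n\<close> samples translates \<open>x\<close> and multiplies by
  \<open>cis (- (\<theta> * real n))\<close>, so \<open>C\<close>, being uniform in
  \<open>x\<close>, bounds every full block; the \<open>r\<close> leftover terms are bounded
  trivially.\<close>

lemma sampled_sum_blocks:
  fixes h :: "real \<Rightarrow> complex"
  assumes B: "\<And>x. norm (h x) \<le> B" and C: "\<And>x. norm (\<Sum>k<n. h (x + real k * d) * cis (- (\<theta> * real k))) \<le> C"
  shows "norm (\<Sum>k<q * n + r. h (x + real k * d) * cis (- (\<theta> * real k))) \<le> real q * C + real r * B"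
proof (induction q arbitrary: x)
  case 0
  have "norm (\<Sum>k<r. h (x + real k * d) * cis (- (\<theta> * real k))) \<le> (\<Sum>k<r. B)"
    by (intro order.trans[OF norm_sum] sum_mono) (simp add: norm_mult B)
  then show ?case by simp
next
  case (Suc q)
  have "(\<Sum>k<Suc q * n + r. h (x + real k * d) * cis (- (\<theta> * real k)))
      = (\<Sum>k<n. h (x + real k * d) * cis (- (\<theta> * real k))) + (\<Sum>k<q * n + r. h (x + real (k + n) * d) * cis (- (\<theta> * real (k + n))))"
    by (simp only: mult_Suc add.assoc sum_lessThan_add)
  also have "(\<Sum>k<q * n + r. h (x + real (k + n) * d) * cis (- (\<theta> * real (k + n))))
      = cis (- (\<theta> * real n)) * (\<Sum>k<q * n + r. h ((x + real n * d) + real k * d) * cis (- (\<theta> * real k)))"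
    unfolding sum_distrib_left by (intro sum.cong refl) (simp add: cis_mult algebra_simps)
  finally have eq: "(\<Sum>k<Suc q * n + r. h (x + real k * d) * cis (- (\<theta> * real k))) =
      (\<Sum>k<n. h (x + real k * d) * cis (- (\<theta> * real k))) +
      cis (- (\<theta> * real n)) * (\<Sum>k<q * n + r. h ((x + real n * d) + real k * d) * cis (- (\<theta> * real k)))" .
  have "norm (\<Sum>k<Suc q * n + r. h (x + real k * d) * cis (- (\<theta> * real k))) \<le> C + (real q * C + real r * B)"
    unfolding eq using C[of x] Suc[of "x + real n * d"]
    by (intro order.trans[OF norm_triangle_ineq] add_mono) (simp_all only: norm_mult norm_cis mult_1)
  then show ?case by (simp add: distrib_right)
qed

lemma norm_cis_diff_le: "norm (cis a - cis b) \<le> \<bar>a - b\<bar>"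
proof -
  have sq: "(cos t - 1)\<^sup>2 + (sin t)\<^sup>2 = (2 * sin (t / 2))\<^sup>2" for t :: real
    using sin_cos_squared_add[of t] cos_double_sin[of "t / 2"] by (simp add: power2_eq_square algebra_simps)
  have *: "norm (cis t - 1) = \<bar>2 * sin (t / 2)\<bar>" for t
    using sq[of t] by (simp only: cmod_def minus_complex.sel cis.sel one_complex.sel diff_zero real_sqrt_abs)
  have "cis a - cis b = cis b * (cis (a - b) - 1)" by (simp add: algebra_simps cis_mult)
  then have "norm (cis a - cis b) = 2 * \<bar>sin ((a - b) / 2)\<bar>"
    by (simp add: norm_mult * abs_mult)
  also have "\<dots> \<le> \<bar>a - b\<bar>" using abs_sin_x_le_abs_x[of "(a - b)/2"] by simp
  finally show ?thesis .
qed

text \<open>The mean at each single frequency \<open>\<theta> / d\<close> vanishes; compactness of \<open>{-pi..pi}\<close> makes this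
  uniform in \<open>\<theta>\<close>.\<close>

lemma sampled_sum_uniformly_small:
  assumes ap: "ap h" and mean: "\<And>\<mu>. has_mean (\<lambda>t. h t * cis (- (\<mu> * t))) 0" and "\<eta> > 0" and "d > 0"
    and osc: "\<And>x y. \<bar>x - y\<bar> \<le> d / 2 \<Longrightarrow> norm (h x - h y) \<le> \<eta> / 16"
  obtains N0 where "\<And>N \<theta> x. N \<ge> N0 \<Longrightarrow> \<bar>\<theta>\<bar> \<le> pi \<Longrightarrow> norm (\<Sum>k<N. h (x + real k * d) * cis (- (\<theta> * real k))) \<le> \<eta> * real N"
proof -
  obtain B where B: "B > 0" "\<And>x. norm (h x) \<le> B" using ap_bounded[OF ap] by blast
  \<comment> \<open>At a fixed frequency one block length serves all \<open>x\<close>. The window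
    bound and the oscillation of \<open>h\<close> contribute \<open>\<eta> / 8\<close> per sample
    each.\<close>
  have single: "\<exists>n>0. \<forall>x. norm (\<Sum>k<n. h (x + real k * d) * cis (- (\<theta> * real k))) \<le> \<eta> / 4 * real n"
    if "\<bar>\<theta>\<bar> \<le> pi" for \<theta>
  proof -
    define G where "G = (\<lambda>t. h t * cis (- (\<theta> / d * t)))"
    have "ap G" unfolding G_def using ap_mult[OF ap ap_cis[of "- (\<theta> / d)"]] by simp
    moreover have "has_mean G 0" unfolding G_def by (rule mean)
    ultimately obtain T0 where T0: "T0 > 0" "\<And>T x. T \<ge> T0 \<Longrightarrow> norm (integral {x-T..x+T} G) \<le> \<eta> / 8 * T"
      using mean_zero_window[of G "\<eta> / 8"] \<open>\<eta> > 0\<close> by auto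
    obtain n :: nat where n: "real n * d > 2 * T0" using reals_Archimedean3[OF \<open>d > 0\<close>] by blast
    have "n > 0" using n T0(1) by (cases n) auto
    moreover have "norm (\<Sum>k<n. h (x + real k * d) * cis (- (\<theta> * real k))) \<le> \<eta> / 4 * real n" for x
    proof -
      define T where "T = real n * d / 2"
      have "integral {x - d/2..x - d/2 + real n * d} G = integral {(x - d/2 + T) - T..(x - d/2 + T) + T} G"
        unfolding T_def by (simp add: algebra_simps)
      also have "norm \<dots> \<le> \<eta> / 8 * T" using n by (intro T0(2)) (simp add: T_def)
      finally have "d / 2 * norm (\<Sum>k<n. h (x + real k * d) * cis (- (\<theta> * real k))) \<le> \<eta> / 8 * T + \<eta> / 16 * d * real n"
        using sampled_sum_le_integral[OF ap_continuous[OF ap] \<open>d > 0\<close> that osc, where n = n and x = x] unfolding G_def by linarith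
      also have "\<dots> = d / 2 * (\<eta> / 4 * real n)" unfolding T_def by (simp add: field_simps)
      finally show ?thesis using \<open>d > 0\<close> by simp
    qed
    ultimately show ?thesis by blast
  qed
  then obtain n where n: "\<And>\<theta>. \<bar>\<theta>\<bar> \<le> pi \<Longrightarrow> n \<theta> > 0"
    "\<And>\<theta> x. \<bar>\<theta>\<bar> \<le> pi \<Longrightarrow> norm (\<Sum>k<n \<theta>. h (x + real k * d) * cis (- (\<theta> * real k))) \<le> \<eta> / 4 * real (n \<theta>)"
    by metis
  \<comment> \<open>Within this radius each of the \<open>n \<theta>\<close> terms changes by at
    most \<open>B * r \<theta> * real (n \<theta>)\<close>, altogether by
    \<open>\<eta> / 4 * real (n \<theta>)\<close>.\<close>
  define r where "r \<theta> = \<eta> / (4 * B * real (n \<theta>))" for \<theta>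
  have rpos: "r \<theta> > 0" if "\<bar>\<theta>\<bar> \<le> pi" for \<theta> using n(1)[OF that] B(1) \<open>\<eta> > 0\<close> by (simp add: r_def)
  have near: "norm (\<Sum>k<n \<theta>. h (x + real k * d) * cis (- (\<theta>' * real k))) \<le> \<eta> / 2 * real (n \<theta>)"
    if "\<bar>\<theta>\<bar> \<le> pi" "\<bar>\<theta>' - \<theta>\<bar> < r \<theta>" for \<theta> \<theta>' x
  proof -
    have "(\<Sum>k<n \<theta>. h (x + real k * d) * cis (- (\<theta>' * real k))) = (\<Sum>k<n \<theta>. h (x + real k * d) * cis (- (\<theta> * real k)))
       + (\<Sum>k<n \<theta>. h (x + real k * d) * (cis (- (\<theta>' * real k)) - cis (- (\<theta> * real k))))"
      by (simp add: algebra_simps sum_subtractf flip: sum.distrib)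
    also have "norm \<dots> \<le> \<eta> / 4 * real (n \<theta>) + (\<Sum>k<n \<theta>. B * (r \<theta> * real (n \<theta>)))"
    proof (intro order.trans[OF norm_triangle_ineq] add_mono n(2)[OF that(1)] order.trans[OF norm_sum] sum_mono)
      fix k assume "k \<in> {..<n \<theta>}"
      have "norm (cis (- (\<theta>' * real k)) - cis (- (\<theta> * real k))) \<le> \<bar>- (\<theta>' * real k) - (- (\<theta> * real k))\<bar>" by (rule norm_cis_diff_le)
      also have "\<dots> = \<bar>\<theta>' - \<theta>\<bar> * real k" by (simp add: abs_mult abs_minus_commute flip: left_diff_distrib)
      also have "\<dots> \<le> r \<theta> * real (n \<theta>)" using that(2) \<open>k \<in> {..<n \<theta>}\<close> by (intro mult_mono) auto
      finally show "norm (h (x + real k * d) * (cis (- (\<theta>' * real k)) - cis (- (\<theta> * real k)))) \<le> B * (r \<theta> * real (n \<theta>))"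
        unfolding norm_mult using B by (intro mult_mono) auto
    qed
    also have "\<dots> = \<eta> / 2 * real (n \<theta>)" using B(1) n(1)[OF that(1)] by (simp add: r_def field_simps)
    finally show ?thesis .
  qed
  have "{-pi..pi} \<subseteq> (\<Union>\<theta>\<in>{-pi..pi}. ball \<theta> (r \<theta>))"
  proof
    fix \<theta> assume *: "\<theta> \<in> {-pi..pi}"
    then have "\<theta> \<in> ball \<theta> (r \<theta>)" using rpos[of \<theta>] by (simp add: abs_le_iff)
    with * show "\<theta> \<in> (\<Union>\<theta>\<in>{-pi..pi}. ball \<theta> (r \<theta>))" by blast
  qed
  then obtain C where C: "C \<subseteq> {-pi..pi}" "finite C" "{-pi..pi} \<subseteq> (\<Union>\<theta>\<in>C. ball \<theta> (r \<theta>))"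
    using compactE_image[OF compact_Icc[of "-pi" pi], of "{-pi..pi}" "\<lambda>\<theta>. ball \<theta> (r \<theta>)"] by (metis open_ball)
  define K where "K = (\<Sum>\<theta>\<in>C. real (n \<theta>))"
  \<comment> \<open>From \<open>N0\<close> on, an incomplete last block of at most \<open>K\<close>
    terms contributes no more than \<open>\<eta> / 2 * real N\<close>.\<close>
  define N0 where "N0 = nat \<lceil>2 * B * K / \<eta>\<rceil>"
  have "norm (\<Sum>k<N. h (x + real k * d) * cis (- (\<theta> * real k))) \<le> \<eta> * real N" if "N \<ge> N0" "\<bar>\<theta>\<bar> \<le> pi" for N \<theta> x
  proof -
    have "\<theta> \<in> {-pi..pi}" using that(2) by (auto simp: abs_le_iff)
    then obtain \<theta>0 where \<theta>0: "\<theta>0 \<in> C" "\<bar>\<theta> - \<theta>0\<bar> < r \<theta>0" using C(3) by (auto simp: dist_real_def)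
    have p: "\<bar>\<theta>0\<bar> \<le> pi" using \<theta>0(1) C(1) by (auto simp: abs_le_iff)
    define m where "m = n \<theta>0"
    have m: "m > 0" unfolding m_def using n(1)[OF p] .
    have mK: "real m \<le> K" unfolding m_def K_def using \<theta>0(1) C(2) by (intro member_le_sum) auto
    have "real N \<ge> 2 * B * K / \<eta>" using that(1) unfolding N0_def by linarith
    then have BK: "B * K \<le> \<eta> / 2 * real N" using \<open>\<eta> > 0\<close> by (simp add: field_simps)
    have "norm (\<Sum>k<(N div m) * m + N mod m. h (x + real k * d) * cis (- (\<theta> * real k))) \<le> real (N div m) * (\<eta> / 2 * real m) + real (N mod m) * B"
      unfolding m_def by (intro sampled_sum_blocks B(2) near[OF p \<theta>0(2)])
    also have "real (N div m) * (\<eta> / 2 * real m) = \<eta> / 2 * real (N div m * m)" by simp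
    also have "\<dots> \<le> \<eta> / 2 * real N" using \<open>\<eta> > 0\<close> by (intro mult_left_mono of_nat_mono) (auto simp: div_times_less_eq_dividend)
    also have "real (N mod m) * B \<le> K * B" using mK m B(1) by (intro mult_right_mono) (auto intro: order.trans[OF _ mK] less_imp_le)
    also have "\<eta> / 2 * real N + K * B \<le> \<eta> * real N" using BK by (simp add: mult.commute)
    finally show ?thesis by simp
  qed
  then show ?thesis using that by blast
qed

text \<open>Pigeonhole: the translations \<open>real k * d\<close> fall into at most
  \<open>card A\<close> classes, and the difference of two members of a class is a translation
  number with tolerance \<open>2 * e\<close>. Subtracting the least member embeds each class into
  the set of return times, so no class is larger than that set.\<close>

lemma return_times:
  fixes h :: "real \<Rightarrow> complex"
  assumes "finite A" and A: "\<And>t::real. \<exists>a\<in>A. \<forall>x. norm (h (x + t) - h (x + a)) \<le> e"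
  shows "real N \<le> real (card A) * real (card {m. m < N \<and> (\<forall>x. norm (h (x + real m * d) - h x) \<le> 2 * e)})"
proof (cases "N = 0")
  case False
  define S where "S = {m. m < N \<and> (\<forall>x. norm (h (x + real m * d) - h x) \<le> 2 * e)}"
  obtain c where c: "\<And>k::nat. c k \<in> A" "\<And>k x. norm (h (x + real k * d) - h (x + c k)) \<le> e"
  proof -
    have "\<forall>k::nat. \<exists>a. a \<in> A \<and> (\<forall>x. norm (h (x + real k * d) - h (x + a)) \<le> e)" using A by blast
    from choice[OF this] that show thesis by blast
  qed
  have "card {k\<in>{..<N}. c k = a} \<le> card S" for a
  proof (cases "{k\<in>{..<N}. c k = a} = {}")
    case False
    define l where "l = Min {k\<in>{..<N}. c k = a}"
    have l: "l < N" "c l = a" "\<And>k. k < N \<Longrightarrow> c k = a \<Longrightarrow> l \<le> k"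
      using Min_in[OF _ False] unfolding l_def by auto
    show ?thesis
    proof (rule card_inj_on_le[of "\<lambda>k. k - l"])
      show "inj_on (\<lambda>k. k - l) {k\<in>{..<N}. c k = a}" using l(3) by (auto simp: inj_on_def) (metis eq_diff_iff)
      show "(\<lambda>k. k - l) ` {k\<in>{..<N}. c k = a} \<subseteq> S"
      proof clarsimp
        fix k assume k: "k < N" "a = c k"
        have "l \<le> k" using l(3) k by auto
        have "norm (h (x + real (k - l) * d) - h x) \<le> 2 * e" for x
        proof -
          have "norm (h ((x - real l * d) + real k * d) - h ((x - real l * d) + c k)) \<le> e" by (rule c(2))
          moreover have "norm (h ((x - real l * d) + real l * d) - h ((x - real l * d) + c l)) \<le> e" by (rule c(2))
          moreover have "c l = c k" using l(2) k by simp
          moreover have "(x - real l * d) + real k * d = x + real (k - l) * d" using \<open>l \<le> k\<close> by (simp add: of_nat_diff algebra_simps)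
          ultimately show ?thesis
            using norm_triangle_ineq4[of "h (x + real (k - l) * d) - h ((x - real l * d) + c k)" "h x - h ((x - real l * d) + c k)"] by simp
        qed
        then show "k - l \<in> S" using k by (auto simp: S_def)
      qed
    qed (simp add: S_def)
  qed (simp only: card.empty le0)
  then have "(\<Sum>a\<in>A. card {k\<in>{..<N}. c k = a}) \<le> (\<Sum>a\<in>A. card S)" by (rule sum_mono)
  moreover have "(\<Sum>a\<in>A. card {k\<in>{..<N}. c k = a}) = N"
    using sum.group[of "{..<N}" A c "\<lambda>_. 1::nat"] assms(1) c(1) by auto
  ultimately have "N \<le> card A * card S" by simp
  then show ?thesis unfolding S_def of_nat_mult[symmetric] of_nat_le_iff .
qed auto


text \<open>Since \<open>k\<close> is an integer, the frequency matters only modulo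
  \<open>2 * pi\<close>. This extends bounds known for \<open>\<bar>\<theta>\<bar> \<le> pi\<close>
  to all frequencies.\<close>

lemma cis_reduce:
  fixes \<theta> :: real
  obtains \<theta>' where "\<bar>\<theta>'\<bar> \<le> pi" "\<And>k::nat. cis (- (\<theta> * real k)) = cis (- (\<theta>' * real k))"
proof -
  define n where "n = \<lfloor>(\<theta> + pi) / (2 * pi)\<rfloor>"
  have "of_int n \<le> (\<theta> + pi) / (2 * pi)" "(\<theta> + pi) / (2 * pi) < of_int n + 1" unfolding n_def by linarith+
  then have "2 * pi * of_int n \<le> \<theta> + pi" "\<theta> + pi < 2 * pi * of_int n + 2 * pi" by (simp_all add: field_simps)
  then have 1: "\<bar>\<theta> - 2 * pi * of_int n\<bar> \<le> pi" by (simp add: abs_le_iff)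
  have "cis (- (\<theta> * real k)) = cis (- ((\<theta> - 2 * pi * of_int n) * real k))" for k :: nat
  proof -
    have "cis (- (\<theta> * real k)) = cis (- ((\<theta> - 2 * pi * of_int n) * real k)) * cis (2 * pi * (- of_int n * real k))"
      unfolding cis_mult by (simp add: algebra_simps)
    also have "cis (2 * pi * (- of_int n * real k)) = 1" by (intro cis_multiple_2pi Ints_mult Ints_minus Ints_of_int Ints_of_nat)
    finally show ?thesis by simp
  qed
  with 1 that show ?thesis by blast
qed

text \<open>If \<open>h\<close> were nonzero, then the samples of \<open>h\<close> on a fine lattice would have a large
  autocorrelation at a positive proportion of the shifts, namely at the almost periods. This
  contradicts the autocorrelation bound, since all the trigonometric sums are small.\<close>

theorem ap_uniqueness:
  assumes ap: "ap h" and mean: "\<And>\<mu>. has_mean (\<lambda>t. h t * cis (- (\<mu> * t))) 0"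
  shows "h x0 = 0"
proof (rule ccontr)
  assume nz: "h x0 \<noteq> 0"
  define c0 where "c0 = norm (h x0)"
  have c0: "c0 > 0" using nz by (simp add: c0_def)
  obtain B where B: "B > 0" "\<And>x. norm (h x) \<le> B" using ap_bounded[OF ap] by blast
  obtain A1 where A1: "finite A1" "\<And>t. \<exists>a\<in>A1. \<forall>x. norm (h (x + t) - h (x + a)) \<le> c0 / 4"
    using ap_finite_translates[OF ap, of "c0 / 4"] c0 by auto
  have a1: "card A1 > 0" using A1 by (auto simp: card_gt_0_iff)
  \<comment> \<open>A lower bound for the mean square of the samples: at least one shift in
    \<open>card A1\<close> is a return time with tolerance \<open>c0 / 2\<close>, and there the
    sample has modulus at least \<open>c0 / 2\<close>.\<close>
  define c where "c = c0\<^sup>2 / (4 * real (card A1))"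
  have c: "c > 0" using c0 a1 by (simp add: c_def)
  \<comment> \<open>Replacing \<open>u (l + m)\<close> by \<open>u l\<close> in the autocorrelation
    costs at most \<open>real L * (2 * e2 * B)\<close>, which is half of the main term
    \<open>c * real N\<close>.\<close>
  define e2 where "e2 = c / (8 * B)"
  have e2: "e2 > 0" using c B(1) by (simp add: e2_def)
  obtain A2 where A2: "finite A2" "\<And>t. \<exists>a\<in>A2. \<forall>x. norm (h (x + t) - h (x + a)) \<le> e2"
    using ap_finite_translates[OF ap e2] by auto
  have a2: "card A2 > 0" using A2 by (auto simp: card_gt_0_iff)
  \<comment> \<open>With this \<open>\<eta>\<close> the final upper bound is
    \<open>real N ^ 3 * (c\<^sup>2 / (8 * real (card A2)))\<close>, below the lower bound
    \<open>real N ^ 3 * (c\<^sup>2 / 4)\<close>.\<close>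
  define \<eta> where "\<eta> = c / (8 * B * real (card A2))"
  have \<eta>: "\<eta> > 0" using c B(1) a2 by (simp add: \<eta>_def)
  obtain d where d: "d > 0" "\<And>x y. \<bar>x - y\<bar> < d \<Longrightarrow> norm (h x - h y) \<le> \<eta> / 16"
    using ap_uniformly_continuous[OF ap, of "\<eta> / 16"] \<eta> by auto
  obtain N0 where N0: "\<And>N \<theta> x. N \<ge> N0 \<Longrightarrow> \<bar>\<theta>\<bar> \<le> pi \<Longrightarrow> norm (\<Sum>k<N. h (x + real k * d) * cis (- (\<theta> * real k))) \<le> \<eta> * real N"
    by (rule sampled_sum_uniformly_small[OF ap mean \<eta> d(1)]) (use d in auto)
  define N where "N = Suc N0"
  \<comment> \<open>Shifts \<open>m < N\<close> then leave at least \<open>N\<close> overlapping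
    terms.\<close>
  define L where "L = 2 * N"
  define u where "u k = h (x0 + real k * d)" for k :: nat
  have Bu: "norm (u k) \<le> B" for k by (simp add: u_def B)
  define G where "G m = (\<Sum>l<L - m. u (l + m) * cnj (u l))" for m
  define S1 where "S1 = {m. m < N \<and> (\<forall>x. norm (h (x + real m * d) - h x) \<le> 2 * (c0 / 4))}"
  define S2 where "S2 = {m. m < N \<and> (\<forall>x. norm (h (x + real m * d) - h x) \<le> 2 * e2)}"
  have S1: "real N \<le> real (card A1) * real (card S1)" unfolding S1_def by (rule return_times[OF A1])
  have S2: "real N \<le> real (card A2) * real (card S2)" unfolding S2_def by (rule return_times[OF A2])
  have E: "norm (\<Sum>k<L. u k * cis (- (\<theta> * real k))) \<le> \<eta> * real L" for \<theta>
  proof -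
    obtain \<theta>' where "\<bar>\<theta>'\<bar> \<le> pi" "\<And>k::nat. cis (- (\<theta> * real k)) = cis (- (\<theta>' * real k))" using cis_reduce by blast
    then show ?thesis using N0[of L \<theta>' x0] by (simp add: u_def L_def N_def)
  qed
  have low: "c * real N \<le> (\<Sum>l<N. (norm (u l))\<^sup>2)"
  proof -
    have "c * real N \<le> c * (real (card A1) * real (card S1))" using S1 c by simp
    also have "\<dots> = (\<Sum>l\<in>S1. (c0 / 2)\<^sup>2)" using a1 by (simp add: c_def power2_eq_square field_simps)
    also have "\<dots> \<le> (\<Sum>l\<in>S1. (norm (u l))\<^sup>2)"
    proof (intro sum_mono power_mono)
      fix l assume "l \<in> S1"
      then have "norm (u l - h x0) \<le> c0 / 2" by (auto simp: S1_def u_def)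
      then show "c0 / 2 \<le> norm (u l)" using norm_triangle_ineq2[of "h x0" "u l"] by (simp add: norm_minus_commute c0_def)
    qed (use c0 in simp)
    also have "\<dots> \<le> (\<Sum>l<N. (norm (u l))\<^sup>2)" by (rule sum_mono2) (auto simp: S1_def)
    finally show ?thesis .
  qed
  have Glow: "c * real N / 2 \<le> norm (G m)" if "m \<in> S2" for m
  proof -
    have m: "m < N" "\<And>l. norm (u (l + m) - u l) \<le> 2 * e2"
    proof -
      have *: "\<And>x. norm (h (x + real m * d) - h x) \<le> 2 * e2" using that by (auto simp: S2_def)
      show "norm (u (l + m) - u l) \<le> 2 * e2" for l using *[of "x0 + real l * d"] by (simp add: u_def algebra_simps)
    qed (use that in \<open>simp add: S2_def\<close>)
    define D where "D = (\<Sum>l<L - m. (u (l + m) - u l) * cnj (u l))"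
    have "G m - D = (\<Sum>l<L - m. u l * cnj (u l))"
      unfolding G_def D_def by (simp add: algebra_simps flip: sum_subtractf)
    also have "\<dots> = of_real (\<Sum>l<L - m. (norm (u l))\<^sup>2)" by (simp only: of_real_sum complex_norm_square)
    finally have GD: "norm (G m - D) = (\<Sum>l<L - m. (norm (u l))\<^sup>2)"
      by (simp only: norm_of_real) (simp add: sum_nonneg)
    have "c * real N \<le> (\<Sum>l<N. (norm (u l))\<^sup>2)" by (rule low)
    also have "\<dots> \<le> (\<Sum>l<L - m. (norm (u l))\<^sup>2)" using m(1) by (intro sum_mono2) (auto simp: L_def)
    finally have 1: "c * real N \<le> norm (G m - D)" unfolding GD .
    have "norm D \<le> (\<Sum>l<L - m. 2 * e2 * B)" unfolding D_def
      by (intro order.trans[OF norm_sum] sum_mono) (use e2 in \<open>auto simp: norm_mult intro!: mult_mono m(2) Bu\<close>)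
    also have "\<dots> = real (L - m) * (c / 4)" using B(1) by (simp add: e2_def)
    also have "\<dots> \<le> real L * (c / 4)" using c by (intro mult_right_mono) auto
    also have "\<dots> = c * real N / 2" by (simp add: L_def)
    finally show ?thesis using 1 norm_triangle_ineq4[of "G m" D] by linarith
  qed
  \<comment> \<open>The return times in \<open>S2\<close>, each contributing at least
    \<open>(c * real N / 2)\<^sup>2\<close>, are set against the autocorrelation bound. Both sides
    have order \<open>real N ^ 3\<close>, so the constants decide.\<close>
  have "real N * (c * real N / 2)\<^sup>2 \<le> real (card A2) * real (card S2) * (c * real N / 2)\<^sup>2"
    using S2 by (intro mult_right_mono) auto
  also have "\<dots> = real (card A2) * (\<Sum>m\<in>S2. (c * real N / 2)\<^sup>2)" by simp
  also have "(\<Sum>m\<in>S2. (c * real N / 2)\<^sup>2) \<le> (\<Sum>m\<in>S2. (norm (G m))\<^sup>2)"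
    using c by (intro sum_mono power_mono Glow) auto
  also have "\<dots> \<le> (\<Sum>m<L. (norm (G m))\<^sup>2)" by (rule sum_mono2) (auto simp: S2_def L_def)
  also have "\<dots> \<le> (\<eta> * real L)\<^sup>2 * (\<Sum>k<L. (norm (u k))\<^sup>2)"
    unfolding G_def by (rule autocorrelation_bound[OF _ E]) (simp add: L_def N_def)
  also have "(\<Sum>k<L. (norm (u k))\<^sup>2) \<le> (\<Sum>k<L. B\<^sup>2)"
    by (intro sum_mono power_mono) (auto simp: u_def B)
  finally have "real N * (c * real N / 2)\<^sup>2 \<le> real (card A2) * ((\<eta> * real L)\<^sup>2 * (real L * B\<^sup>2))"
    by (simp add: mult_left_mono)
  also have "\<dots> = real N ^ 3 * (c\<^sup>2 / (8 * real (card A2)))"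
    using B(1) a2 by (simp add: L_def \<eta>_def field_simps power2_eq_square power3_eq_cube)
  also have "\<dots> \<le> real N ^ 3 * (c\<^sup>2 / 8)"
    using a2 by (intro mult_left_mono divide_left_mono) auto
  also have "\<dots> < real N ^ 3 * (c\<^sup>2 / 4)" using c by (simp add: N_def)
  also have "\<dots> = real N * (c * real N / 2)\<^sup>2" by (simp add: power2_eq_square power3_eq_cube)
  finally show False by simp
qed

section \<open>Fourier coefficients in the strip\<close>

lemma has_mean_unique: "has_mean F a \<Longrightarrow> has_mean F b \<Longrightarrow> a = b"
  unfolding has_mean_def by (rule tendsto_unique[OF trivial_limit_at_top_linorder])

lemma has_mean_cmult:
  assumes "has_mean F a" shows "has_mean (\<lambda>t. c * F t) (c * a)"
proof -
  have "((\<lambda>T. c * (complex_of_real (1 / (2 * T)) * integral {-T..T} F)) \<longlongrightarrow> c * a) at_top"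
    using assms unfolding has_mean_def by (rule tendsto_mult_left)
  then show ?thesis unfolding has_mean_def by (simp add: mult.left_commute)
qed

lemma has_mean_sum:
  assumes "finite A" "\<And>i. i \<in> A \<Longrightarrow> continuous_on UNIV (F i)" "\<And>i. i \<in> A \<Longrightarrow> has_mean (F i) (a i)"
  shows "has_mean (\<lambda>t. \<Sum>i\<in>A. F i t) (\<Sum>i\<in>A. a i)"
proof -
  have "((\<lambda>T. \<Sum>i\<in>A. complex_of_real (1 / (2 * T)) * integral {-T..T} (F i)) \<longlongrightarrow> (\<Sum>i\<in>A. a i)) at_top"
    using assms(3) unfolding has_mean_def by (rule tendsto_sum)
  moreover have "(\<Sum>i\<in>A. complex_of_real (1 / (2 * T)) * integral {-T..T} (F i)) =
      complex_of_real (1 / (2 * T)) * integral {-T..T} (\<lambda>t. \<Sum>i\<in>A. F i t)" for T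
    using assms(1,2) by (subst integral_sum) (auto simp: sum_distrib_left intro: continuous_integrable)
  ultimately show ?thesis unfolding has_mean_def by simp
qed

lemma has_mean_diff:
  assumes "continuous_on UNIV F" "continuous_on UNIV G" "has_mean F a" "has_mean G b"
  shows "has_mean (\<lambda>t. F t - G t) (a - b)"
proof -
  have "((\<lambda>T. complex_of_real (1 / (2 * T)) * integral {-T..T} F - complex_of_real (1 / (2 * T)) * integral {-T..T} G) \<longlongrightarrow> a - b) at_top"
    using assms(3,4) unfolding has_mean_def by (rule tendsto_diff)
  then show ?thesis unfolding has_mean_def
    using assms(1,2) by (subst integral_diff) (auto simp: right_diff_distrib intro: continuous_integrable)
qed

lemma has_mean_cis: "has_mean (\<lambda>t. cis (\<mu> * t)) (if \<mu> = 0 then 1 else 0)"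
proof (cases "\<mu> = 0")
  case True
  have "\<forall>\<^sub>F T in at_top. complex_of_real (1 / (2 * T)) * integral {-T..T} (\<lambda>t. 1) = 1"
    using eventually_gt_at_top[of 0] by eventually_elim (simp add: scaleR_conv_of_real)
  then have "((\<lambda>T. complex_of_real (1 / (2 * T)) * integral {-T..T} (\<lambda>t. 1)) \<longlongrightarrow> 1) at_top"
    by (rule tendsto_eventually)
  with True show ?thesis by (simp add: has_mean_def)
next
  case False
  have "norm (complex_of_real (1 / (2 * T)) * integral {-T..T} (\<lambda>t. cis (\<mu> * t))) \<le> 1 / \<bar>\<mu>\<bar> * inverse T" if "T > 0" for T
  proof -
    have "((\<lambda>t. cis (\<mu> * t)) has_integral (cis (\<mu> * T) / (\<i> * \<mu>) - cis (\<mu> * (-T)) / (\<i> * \<mu>))) {-T..T}"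
    proof (rule fundamental_theorem_of_calculus)
      fix x
      have "((\<lambda>z. exp (\<i> * of_real \<mu> * z) / (\<i> * of_real \<mu>)) has_field_derivative exp (\<i> * of_real \<mu> * of_real x)) (at (of_real x))"
        using False by (auto intro!: derivative_eq_intros)
      from has_vector_derivative_real_field[OF this]
      show "((\<lambda>t. cis (\<mu> * t) / (\<i> * \<mu>)) has_vector_derivative cis (\<mu> * x)) (at x within {-T..T})"
        by (simp add: cis_conv_exp mult.assoc)
    qed (use that in simp)
    then have "norm (integral {-T..T} (\<lambda>t. cis (\<mu> * t))) \<le> 2 / \<bar>\<mu>\<bar>"
      using norm_triangle_ineq4[of "cis (\<mu> * T) / (\<i> * \<mu>)" "cis (\<mu> * (-T)) / (\<i> * \<mu>)"]
      by (simp add: integral_unique norm_divide norm_mult)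
    then have "1 / (2 * T) * norm (integral {-T..T} (\<lambda>t. cis (\<mu> * t))) \<le> 1 / (2 * T) * (2 / \<bar>\<mu>\<bar>)"
      using that by (intro mult_left_mono) auto
    with that show ?thesis by (simp add: norm_mult norm_divide field_simps)
  qed
  then have ev: "\<forall>\<^sub>F T in at_top. norm (complex_of_real (1 / (2 * T)) * integral {-T..T} (\<lambda>t. cis (\<mu> * t))) \<le> 1 / \<bar>\<mu>\<bar> * inverse T"
    using eventually_gt_at_top[of 0] by (rule eventually_mono[rotated]) auto
  have "((\<lambda>T. 1 / \<bar>\<mu>\<bar> * inverse T) \<longlongrightarrow> 0) at_top"
    by (intro tendsto_mult_right_zero tendsto_inverse_0_at_top filterlim_ident)
  from Lim_null_comparison[OF ev this] False show ?thesis by (simp add: has_mean_def)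
qed

lemma has_mean_uniform_limit:
  assumes cont: "\<And>n. continuous_on UNIV (F n)" and lim: "uniform_limit UNIV F G sequentially"
    and mean: "\<And>n. has_mean (F n) (c n)" and c: "c \<longlonglongrightarrow> L"
  shows "has_mean G L"
  unfolding has_mean_def
proof (rule tendstoI)
  fix e :: real assume "e > 0"
  have contG: "continuous_on UNIV G"
    by (rule uniform_limit_theorem[OF _ lim]) (auto intro!: always_eventually cont)
  have "\<forall>\<^sub>F n in sequentially. (\<forall>x\<in>UNIV. dist (F n x) (G x) < e / 3) \<and> dist (c n) L < e / 3"
    using \<open>e > 0\<close> by (intro eventually_conj uniform_limitD[OF lim] tendstoD[OF c]) auto
  then obtain n where n: "\<And>x. dist (F n x) (G x) < e / 3" "dist (c n) L < e / 3"
    by (auto simp: eventually_sequentially)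
  have "\<forall>\<^sub>F T in at_top. dist (complex_of_real (1 / (2 * T)) * integral {-T..T} (F n)) (c n) < e / 3"
    using mean[of n] \<open>e > 0\<close> unfolding has_mean_def by (intro tendstoD) auto
  then show "\<forall>\<^sub>F T in at_top. dist (complex_of_real (1 / (2 * T)) * integral {-T..T} G) L < e"
    using eventually_gt_at_top[of 0]
  proof eventually_elim
    case (elim T)
    have "integral {-T..T} (F n) - integral {-T..T} G = integral {-T..T} (\<lambda>t. F n t - G t)"
      by (rule integral_diff[symmetric]) (auto intro: continuous_integrable cont contG)
    also have "norm \<dots> \<le> e / 3 * (T - (-T))"
      using elim n(1) by (intro integral_bound continuous_intros continuous_on_subset[OF cont] continuous_on_subset[OF contG])
        (auto simp: dist_norm less_imp_le)
    finally have "1 / (2 * T) * norm (integral {-T..T} (F n) - integral {-T..T} G) \<le> 1 / (2 * T) * (e / 3 * (T - (-T)))"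
      using elim by (intro mult_left_mono) auto
    then have "dist (complex_of_real (1 / (2 * T)) * integral {-T..T} (F n)) (complex_of_real (1 / (2 * T)) * integral {-T..T} G) \<le> e / 3"
      using elim by (simp only: dist_norm right_diff_distrib[symmetric] norm_mult norm_of_real) simp
    then show ?case using elim(1) n(2)
      dist_triangle3[of "complex_of_real (1 / (2 * T)) * integral {-T..T} G" L "complex_of_real (1 / (2 * T)) * integral {-T..T} (F n)"]
      dist_triangle[of "complex_of_real (1 / (2 * T)) * integral {-T..T} (F n)" L "c n"] by linarith
  qed
qed

section \<open>Vertical lines and reduced strips\<close>

lemma open_vstrip: "open (vstrip \<alpha> \<beta>)"
proof -
  have "vstrip \<alpha> \<beta> = Re -` (ereal -` {\<alpha><..<\<beta>})" by (auto simp: vstrip_def)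
  moreover have "open (ereal -` {\<alpha><..<\<beta>})" by (intro open_ereal_vimage open_greaterThanLessThan)
  then have "open (Re -` (ereal -` {\<alpha><..<\<beta>}))" by (intro open_vimage continuous_intros)
  ultimately show ?thesis by simp
qed

lemma between_in_strip:
  "\<alpha> < ereal a \<Longrightarrow> ereal b < \<beta> \<Longrightarrow> a \<le> x \<Longrightarrow> x \<le> b \<Longrightarrow> \<alpha> < ereal x \<and> ereal x < \<beta>"
  by (meson ereal_less_eq(3) less_le_trans le_less_trans)

lemma convex_vstrip: "convex (vstrip \<alpha> \<beta>)"
proof -
  have "convex (Re -` (ereal -` {\<alpha><..<\<beta>}))"
  proof (intro convex_linear_vimage)
    show "linear Re" by (simp add: linear_iff)
    have "is_interval (ereal -` {\<alpha><..<\<beta>})"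
      unfolding is_interval_1
      by (intro ballI allI impI) (metis between_in_strip vimage_eq greaterThanLessThan_iff)
    then show "convex (ereal -` {\<alpha><..<\<beta>})" by (simp add: is_interval_convex_1)
  qed
  moreover have "vstrip \<alpha> \<beta> = Re -` (ereal -` {\<alpha><..<\<beta>})" by (auto simp: vstrip_def)
  ultimately show ?thesis by simp
qed

lemma reduced_strip_in_vstrip:
  "\<alpha> < ereal \<sigma>1 \<Longrightarrow> ereal \<sigma>2 < \<beta> \<Longrightarrow> {s. \<sigma>1 \<le> Re s \<and> Re s \<le> \<sigma>2} \<subseteq> vstrip \<alpha> \<beta>"
  using between_in_strip[of \<alpha> \<sigma>1 \<sigma>2 \<beta>] by (auto simp: vstrip_def)

lemma strip_inner_interval:
  assumes "\<alpha> < ereal \<sigma>" "ereal \<sigma> < \<beta>"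
  obtains \<delta> where "\<delta> > 0" "\<alpha> < ereal (\<sigma> - \<delta>)" "ereal (\<sigma> + \<delta>) < \<beta>"
proof -
  obtain u where u: "\<alpha> < ereal u" "ereal u < ereal \<sigma>" using ereal_dense2[OF assms(1)] by blast
  obtain v where v: "ereal \<sigma> < ereal v" "ereal v < \<beta>" using ereal_dense2[OF assms(2)] by blast
  define \<delta> where "\<delta> = min (\<sigma> - u) (v - \<sigma>)"
  have "\<delta> > 0" using u v by (simp add: \<delta>_def)
  moreover have "\<alpha> < ereal (\<sigma> - \<delta>)" by (rule less_le_trans[OF u(1)]) (simp add: \<delta>_def)
  moreover have "ereal (\<sigma> + \<delta>) < \<beta>" by (rule le_less_trans[OF _ v(2)]) (simp add: \<delta>_def)
  ultimately show ?thesis using that by blast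
qed

lemma almost_periodic_strip_bohr:
  assumes "almost_periodic_strip \<alpha> \<beta> f" "\<alpha> < ereal \<sigma>1" "\<sigma>1 < \<sigma>2" "ereal \<sigma>2 < \<beta>" "e > 0"
  obtains l where "l > 0" "\<And>x. \<exists>\<tau>\<in>{x..x + l}. \<forall>\<sigma> t. \<sigma>1 \<le> \<sigma> \<longrightarrow> \<sigma> \<le> \<sigma>2 \<longrightarrow>
     norm (f (Complex \<sigma> (t + \<tau>)) - f (Complex \<sigma> t)) \<le> e"
proof -
  obtain l where l: "l > 0" "\<And>x::real. \<exists>\<tau>\<in>{x..x + l}. \<forall>s. \<sigma>1 \<le> Re s \<and> Re s \<le> \<sigma>2 \<longrightarrow>
            norm (f (s + \<i> * complex_of_real \<tau>) - f s) \<le> e"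
    using assms unfolding almost_periodic_strip_def by blast
  have "\<exists>\<tau>\<in>{x..x + l}. \<forall>\<sigma> t. \<sigma>1 \<le> \<sigma> \<longrightarrow> \<sigma> \<le> \<sigma>2 \<longrightarrow> norm (f (Complex \<sigma> (t + \<tau>)) - f (Complex \<sigma> t)) \<le> e" for x
  proof -
    obtain \<tau> where \<tau>: "\<tau> \<in> {x..x + l}" "\<And>s. \<sigma>1 \<le> Re s \<Longrightarrow> Re s \<le> \<sigma>2 \<Longrightarrow> norm (f (s + \<i> * complex_of_real \<tau>) - f s) \<le> e"
      using l(2)[of x] by blast
    have "norm (f (Complex \<sigma> (t + \<tau>)) - f (Complex \<sigma> t)) \<le> e" if "\<sigma>1 \<le> \<sigma>" "\<sigma> \<le> \<sigma>2" for \<sigma> t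
    proof -
      have "Complex \<sigma> (t + \<tau>) = Complex \<sigma> t + \<i> * complex_of_real \<tau>" by (simp add: complex_eq_iff)
      with \<tau>(2)[of "Complex \<sigma> t"] that show ?thesis by simp
    qed
    with \<tau>(1) show ?thesis by blast
  qed
  with l(1) that show ?thesis by blast
qed

lemma continuous_vertical:
  assumes "almost_periodic_strip \<alpha> \<beta> f" "\<alpha> < ereal \<sigma>" "ereal \<sigma> < \<beta>"
  shows "continuous_on S (\<lambda>t. f (Complex \<sigma> t))"
proof -
  have "continuous_on (vstrip \<alpha> \<beta>) f"
    using assms(1) unfolding almost_periodic_strip_def
    by (meson analytic_imp_holomorphic holomorphic_on_imp_continuous_on)
  then show ?thesis
    by (rule continuous_on_compose2) (use assms in \<open>auto simp: vstrip_def Complex_eq intro!: continuous_intros\<close>)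
qed

lemma ap_vertical:
  assumes "almost_periodic_strip \<alpha> \<beta> f" "\<alpha> < ereal \<sigma>" "ereal \<sigma> < \<beta>"
  shows "ap (\<lambda>t. f (Complex \<sigma> t))"
proof (rule ap_bohr)
  show "continuous_on UNIV (\<lambda>t. f (Complex \<sigma> t))" using continuous_vertical[OF assms] .
  fix e :: real assume "e > 0"
  \<comment> \<open>Translation numbers are provided for strips of positive width, so the line is
    enclosed in one.\<close>
  obtain \<delta> where \<delta>: "\<delta> > 0" "\<alpha> < ereal (\<sigma> - \<delta>)" "ereal (\<sigma> + \<delta>) < \<beta>" using strip_inner_interval[OF assms(2,3)] .
  obtain l where l: "l > 0" "\<And>x. \<exists>\<tau>\<in>{x..x + l}. \<forall>\<sigma>' t. \<sigma> - \<delta> \<le> \<sigma>' \<longrightarrow> \<sigma>' \<le> \<sigma> + \<delta> \<longrightarrow>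
     norm (f (Complex \<sigma>' (t + \<tau>)) - f (Complex \<sigma>' t)) \<le> e"
    using almost_periodic_strip_bohr[OF assms(1) \<delta>(2) _ \<delta>(3) \<open>e > 0\<close>] \<delta>(1) by auto
  have "\<exists>\<tau>\<in>{x..x + l}. \<forall>t. norm (f (Complex \<sigma> (t + \<tau>)) - f (Complex \<sigma> t)) \<le> e" for x
  proof -
    from l(2)[of x] obtain \<tau> where "\<tau> \<in> {x..x + l}" "\<forall>\<sigma>' t. \<sigma> - \<delta> \<le> \<sigma>' \<longrightarrow> \<sigma>' \<le> \<sigma> + \<delta> \<longrightarrow>
       norm (f (Complex \<sigma>' (t + \<tau>)) - f (Complex \<sigma>' t)) \<le> e" ..
    with \<delta>(1) show ?thesis by (intro bexI[of _ \<tau>]) auto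
  qed
  with l(1) show "\<exists>l>0. \<forall>x. \<exists>\<tau>\<in>{x..x + l}. \<forall>t. norm (f (Complex \<sigma> (t + \<tau>)) - f (Complex \<sigma> t)) \<le> e" by blast
qed

text \<open>A translation number brings any point of the reduced strip into a compact rectangle of
  height \<open>l\<close>, changing the value of \<open>f\<close> by at most 1.\<close>

lemma bounded_reduced_strip:
  assumes "almost_periodic_strip \<alpha> \<beta> f" "\<alpha> < ereal \<sigma>1" "\<sigma>1 < \<sigma>2" "ereal \<sigma>2 < \<beta>"
  obtains B where "B > 0" "\<And>s. \<sigma>1 \<le> Re s \<Longrightarrow> Re s \<le> \<sigma>2 \<Longrightarrow> norm (f s) \<le> B"
proof -
  obtain l where l: "l > 0" "\<And>x. \<exists>\<tau>\<in>{x..x + l}. \<forall>\<sigma> t. \<sigma>1 \<le> \<sigma> \<longrightarrow> \<sigma> \<le> \<sigma>2 \<longrightarrow>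
     norm (f (Complex \<sigma> (t + \<tau>)) - f (Complex \<sigma> t)) \<le> 1"
    using almost_periodic_strip_bohr[OF assms, of 1] by auto
  define K where "K = cbox (Complex \<sigma>1 0) (Complex \<sigma>2 l)"
  have "K \<subseteq> vstrip \<alpha> \<beta>"
    using reduced_strip_in_vstrip[OF assms(2,4)] by (auto simp: K_def in_cbox_complex_iff)
  then have "continuous_on K f"
    using assms(1) unfolding almost_periodic_strip_def
    by (meson analytic_imp_holomorphic holomorphic_on_imp_continuous_on continuous_on_subset)
  then have "bounded (f ` K)" by (intro compact_imp_bounded compact_continuous_image) (auto simp: K_def)
  then obtain B where B: "B > 0" "\<And>s. s \<in> K \<Longrightarrow> norm (f s) \<le> B" by (auto simp: bounded_pos)
  have "norm (f s) \<le> B + 1" if s: "\<sigma>1 \<le> Re s" "Re s \<le> \<sigma>2" for s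
  proof -
    obtain \<tau> where \<tau>: "\<tau> \<in> {-Im s..-Im s + l}" "norm (f (Complex (Re s) (Im s + \<tau>)) - f s) \<le> 1"
    proof -
      from l(2)[of "- Im s"] obtain \<tau> where "\<tau> \<in> {-Im s..-Im s + l}"
        "\<forall>\<sigma> t. \<sigma>1 \<le> \<sigma> \<longrightarrow> \<sigma> \<le> \<sigma>2 \<longrightarrow> norm (f (Complex \<sigma> (t + \<tau>)) - f (Complex \<sigma> t)) \<le> 1" ..
      then show thesis using that[of \<tau>] s by (metis complex.collapse)
    qed
    have "Complex (Re s) (Im s + \<tau>) \<in> K" using \<tau>(1) s by (auto simp: K_def in_cbox_complex_iff)
    then show ?thesis using B(2) \<tau>(2) norm_triangle_ineq2[of "f s" "f (Complex (Re s) (Im s + \<tau>))"]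
      by (smt (verit) norm_minus_commute)
  qed
  with B(1) that[of "B + 1"] show ?thesis by simp
qed

text \<open>Cauchy's theorem for a rectangle, phrased with a primitive \<open>G\<close>: the
  vertical integrals differ by the two horizontal sides, whose contribution is bounded independently
  of \<open>T\<close>. Division by \<open>2 * T\<close> makes it disappear, which is why Fourier
  coefficients do not depend on the abscissa.\<close>

lemma vertical_integral_diff_le:
  assumes holo: "g holomorphic_on vstrip \<alpha> \<beta>" and \<sigma>: "\<alpha> < ereal \<sigma>1" "\<sigma>1 \<le> \<sigma>2" "ereal \<sigma>2 < \<beta>"
    and B: "\<And>s. \<sigma>1 \<le> Re s \<Longrightarrow> Re s \<le> \<sigma>2 \<Longrightarrow> norm (g s) \<le> B" and "T \<ge> 0"
  shows "norm (integral {-T..T} (\<lambda>t. g (Complex \<sigma>1 t)) - integral {-T..T} (\<lambda>t. g (Complex \<sigma>2 t))) \<le> 2 * B * (\<sigma>2 - \<sigma>1)"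
proof -
  obtain G where G: "\<And>s. s \<in> vstrip \<alpha> \<beta> \<Longrightarrow> (G has_field_derivative g s) (at s)"
    using holomorphic_convex_primitive'[OF convex_vstrip open_vstrip holo] open_vstrip by (metis at_within_open)
  have sub: "{s. \<sigma>1 \<le> Re s \<and> Re s \<le> \<sigma>2} \<subseteq> vstrip \<alpha> \<beta>" by (rule reduced_strip_in_vstrip[OF \<sigma>(1,3)])
  have I: "\<i> * integral {-T..T} (\<lambda>t. g (Complex \<sigma> t)) = G (Complex \<sigma> T) - G (Complex \<sigma> (-T))"
    if "\<sigma>1 \<le> \<sigma>" "\<sigma> \<le> \<sigma>2" for \<sigma>
  proof -
    have "((\<lambda>t. \<i> * g (Complex \<sigma> t)) has_integral (G (Complex \<sigma> T) - G (Complex \<sigma> (-T)))) {-T..T}"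
    proof (rule fundamental_theorem_of_calculus)
      fix x
      have D: "((\<lambda>t. Complex \<sigma> t) has_vector_derivative \<i>) (at x within {-T..T})"
        unfolding Complex_eq by (auto intro!: derivative_eq_intros)
      have "Complex \<sigma> x \<in> vstrip \<alpha> \<beta>" using sub that by auto
      then have "(G has_field_derivative g (Complex \<sigma> x)) (at (Complex \<sigma> x) within (\<lambda>t. Complex \<sigma> t) ` {-T..T})"
        using G by (blast intro: has_field_derivative_at_within)
      from field_vector_diff_chain_within[OF D this]
      show "((\<lambda>t. G (Complex \<sigma> t)) has_vector_derivative \<i> * g (Complex \<sigma> x)) (at x within {-T..T})"
        by (simp add: o_def)
    qed (use assms(6) in simp)
    then show ?thesis by (simp flip: integral_mult_right add: integral_unique)
  qed
  have horiz: "norm (G (Complex \<sigma>1 t) - G (Complex \<sigma>2 t)) \<le> B * (\<sigma>2 - \<sigma>1)" for t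
  proof -
    have "norm (G (Complex \<sigma>1 t) - G (Complex \<sigma>2 t)) \<le> B * norm (Complex \<sigma>1 t - Complex \<sigma>2 t)"
    proof (rule field_differentiable_bound[of "{s. \<sigma>1 \<le> Re s \<and> Re s \<le> \<sigma>2}" G g])
      show "convex {s. \<sigma>1 \<le> Re s \<and> Re s \<le> \<sigma>2}"
        using convex_Int[OF convex_halfspace_Re_ge[of \<sigma>1] convex_halfspace_Re_le[of \<sigma>2]]
        by (simp add: Collect_conj_eq)
    qed (use G sub B \<sigma> in \<open>auto intro: has_field_derivative_at_within\<close>)
    then show ?thesis using \<sigma>(2) by (simp add: complex_diff cmod_def)
  qed
  have "norm (integral {-T..T} (\<lambda>t. g (Complex \<sigma>1 t)) - integral {-T..T} (\<lambda>t. g (Complex \<sigma>2 t)))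
     = norm (\<i> * integral {-T..T} (\<lambda>t. g (Complex \<sigma>1 t)) - \<i> * integral {-T..T} (\<lambda>t. g (Complex \<sigma>2 t)))"
    by (simp add: norm_mult flip: right_diff_distrib)
  also have "\<dots> = norm ((G (Complex \<sigma>1 T) - G (Complex \<sigma>2 T)) - (G (Complex \<sigma>1 (-T)) - G (Complex \<sigma>2 (-T))))"
    unfolding I[OF order_refl \<sigma>(2)] I[OF \<sigma>(2) order_refl] by (simp add: algebra_simps)
  also have "\<dots> \<le> B * (\<sigma>2 - \<sigma>1) + B * (\<sigma>2 - \<sigma>1)"
    by (intro order.trans[OF norm_triangle_ineq4] add_mono horiz)
  finally show ?thesis by simp
qed

text \<open>This justifies the definite description: almost periodicity gives the mean on one line,
  the comparison of vertical integrals carries it to every other line, and limits are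
  unique.\<close>

lemma has_mean_fourier_coeff:
  assumes f: "almost_periodic_strip \<alpha> \<beta> f" and \<sigma>: "\<alpha> < ereal \<sigma>" "ereal \<sigma> < \<beta>"
  shows "has_mean (\<lambda>t. f (Complex \<sigma> t) * exp (- complex_of_real l * Complex \<sigma> t)) (fourier_coeff \<alpha> \<beta> f l)"
proof -
  define g where "g s = f s * exp (- complex_of_real l * s)" for s
  have "f holomorphic_on vstrip \<alpha> \<beta>"
    using f unfolding almost_periodic_strip_def by (blast intro: analytic_imp_holomorphic)
  then have holo: "g holomorphic_on vstrip \<alpha> \<beta>"
    unfolding g_def by (intro holomorphic_intros)
  have gv: "g (Complex \<sigma>' t) = exp (- of_real (l * \<sigma>')) * (f (Complex \<sigma>' t) * cis (- l * t))" for \<sigma>' t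
  proof -
    have "exp (- complex_of_real l * Complex \<sigma>' t) = exp (- of_real (l * \<sigma>')) * cis (- l * t)"
      unfolding cis_conv_exp exp_add[symmetric] by (intro arg_cong[of _ _ exp]) (simp add: complex_eq_iff)
    then show ?thesis by (simp add: g_def mult_ac)
  qed
  have "ap (\<lambda>t. g (Complex \<sigma> t))"
    unfolding gv by (intro ap_mult ap_const ap_vertical[OF f \<sigma>] ap_cis)
  then obtain c where c: "has_mean (\<lambda>t. g (Complex \<sigma> t)) c" using ap_has_mean by blast
  have step: "has_mean (\<lambda>t. g (Complex \<sigma>2 t)) c'" 
    if \<sigma>12: "\<alpha> < ereal \<sigma>1" "ereal \<sigma>1 < \<beta>" "\<alpha> < ereal \<sigma>2" "ereal \<sigma>2 < \<beta>" and m: "has_mean (\<lambda>t. g (Complex \<sigma>1 t)) c'" for \<sigma>1 \<sigma>2 c'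
  proof (cases "\<sigma>1 = \<sigma>2")
    case False
    define u where "u = min \<sigma>1 \<sigma>2"
    define v where "v = max \<sigma>1 \<sigma>2"
    have uv: "\<alpha> < ereal u" "u < v" "ereal v < \<beta>" using \<sigma>12 False by (auto simp: u_def v_def min_def max_def)
    obtain B where B: "B > 0" "\<And>s. u \<le> Re s \<Longrightarrow> Re s \<le> v \<Longrightarrow> norm (f s) \<le> B"
      using bounded_reduced_strip[OF f uv] by blast
    define B' where "B' = B * exp (\<bar>l\<bar> * (\<bar>u\<bar> + \<bar>v\<bar>))"
    have B': "norm (g s) \<le> B'" if "u \<le> Re s" "Re s \<le> v" for s
    proof -
      have "- (l * Re s) \<le> \<bar>l\<bar> * \<bar>Re s\<bar>" by (metis abs_ge_minus_self abs_mult)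
      also have "\<dots> \<le> \<bar>l\<bar> * (\<bar>u\<bar> + \<bar>v\<bar>)" using that by (intro mult_left_mono) auto
      finally show ?thesis using B that unfolding g_def B'_def by (auto simp: norm_mult intro!: mult_mono)
    qed
    have D: "norm (integral {-T..T} (\<lambda>t. g (Complex \<sigma>2 t)) - integral {-T..T} (\<lambda>t. g (Complex \<sigma>1 t))) \<le> 2 * B' * (v - u)" if "T \<ge> 0" for T
      using vertical_integral_diff_le[OF holo uv(1) less_imp_le[OF uv(2)] uv(3) B' that] unfolding u_def v_def
      by (auto simp: min_def max_def norm_minus_commute split: if_splits)
    have ev: "\<forall>\<^sub>F T in at_top. norm (complex_of_real (1 / (2 * T)) * integral {-T..T} (\<lambda>t. g (Complex \<sigma>2 t)) - complex_of_real (1 / (2 * T)) * integral {-T..T} (\<lambda>t. g (Complex \<sigma>1 t))) \<le> B' * (v - u) * inverse T"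
      using eventually_gt_at_top[of 0]
    proof eventually_elim
      case (elim T)
      then have "1 / (2 * T) * norm (integral {-T..T} (\<lambda>t. g (Complex \<sigma>2 t)) - integral {-T..T} (\<lambda>t. g (Complex \<sigma>1 t))) \<le> 1 / (2 * T) * (2 * B' * (v - u))"
        by (intro mult_left_mono D) auto
      with elim show ?case
        by (simp only: right_diff_distrib[symmetric] norm_mult norm_of_real) (simp add: field_simps)
    qed
    have "((\<lambda>T. B' * (v - u) * inverse T) \<longlongrightarrow> 0) at_top"
      by (intro tendsto_mult_right_zero tendsto_inverse_0_at_top filterlim_ident)
    from tendsto_add[OF Lim_null_comparison[OF ev this] m[unfolded has_mean_def]]
    show ?thesis by (simp add: has_mean_def)
  qed (use m in simp)
  define Q where "Q c \<longleftrightarrow> (\<forall>\<sigma>::real. \<alpha> < ereal \<sigma> \<and> ereal \<sigma> < \<beta> \<longrightarrow> has_mean (\<lambda>t. g (Complex \<sigma> t)) c)" for c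
  have "Q c" unfolding Q_def using step[OF \<sigma> _ _ c] by blast
  moreover have "c' = c" if "Q c'" for c' using that c \<sigma> has_mean_unique unfolding Q_def by blast
  ultimately have "(THE c. Q c) = c" by (rule the_equality)
  moreover have "fourier_coeff \<alpha> \<beta> f l = (THE c. Q c)"
    unfolding fourier_coeff_def Q_def has_mean_def g_def ..
  ultimately show ?thesis using c unfolding g_def by simp
qed

text \<open>The real part of the exponent is constant on the line and can be split off. The modulus
  of the resulting coefficient at a Fourier exponent is the quantity compared in the
  criterion.\<close>

lemma has_mean_vertical:
  assumes f: "almost_periodic_strip \<alpha> \<beta> f" and \<sigma>: "\<alpha> < ereal \<sigma>" "ereal \<sigma> < \<beta>"
  shows "has_mean (\<lambda>t. f (Complex \<sigma> t) * cis (- (l * t))) (fourier_coeff \<alpha> \<beta> f l * exp (of_real (l * \<sigma>)))"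
proof -
  have eq: "f (Complex \<sigma> t) * cis (- (l * t)) = exp (of_real (l * \<sigma>)) * (f (Complex \<sigma> t) * exp (- complex_of_real l * Complex \<sigma> t))" for t
  proof -
    have "cis (- (l * t)) = exp (of_real (l * \<sigma>)) * exp (- complex_of_real l * Complex \<sigma> t)"
      unfolding cis_conv_exp exp_add[symmetric] by (intro arg_cong[of _ _ exp]) (simp add: complex_eq_iff)
    then show ?thesis by (simp add: mult_ac)
  qed
  show ?thesis
    unfolding eq using has_mean_cmult[OF has_mean_fourier_coeff[OF assms], of "exp (of_real (l * \<sigma>))" l]
    by (simp only: mult.commute)
qed

section \<open>Absolute convergence of the Dirichlet series\<close>

lemma rat_independent_int_combination:
  fixes k :: "real \<Rightarrow> int"
  assumes "rat_real.independent S" "finite J" "J \<subseteq> S" "(\<Sum>x\<in>J. of_int (k x) * x) = 0" "x \<in> J"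
  shows "k x = 0"
  using rat_real.independentD[OF assms(1-3), of "\<lambda>x. of_int (k x)" x] assms(4,5) by simp

lemma prod_cis: "(\<Prod>x\<in>A. cis (g x)) = cis (\<Sum>x\<in>A. g x)"
  by (induction A rule: infinite_finite_induct) (simp_all add: cis_mult)

text \<open>The Riesz product \<open>\<Prod>\<mu>\<in>J. 1 + Re (cnj (sgn (c \<mu>)) * cis (- \<mu> * t))\<close> is nonnegative with
  mean 1, and by independence its only frequencies in \<open>S\<close> are the elements of \<open>J\<close>.\<close>

lemma riesz_product_bound:
  fixes F :: "real \<Rightarrow> complex"
  assumes cont: "continuous_on UNIV F" and B: "\<And>t. norm (F t) \<le> B"
    and mean: "\<And>\<mu>. has_mean (\<lambda>t. F t * cis (- (\<mu> * t))) (c \<mu>)"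
    and ind: "rat_real.independent S" and zero: "\<And>\<mu>. \<mu> \<notin> S \<Longrightarrow> c \<mu> = 0"
    and J: "finite J" "J \<subseteq> S"
  shows "(\<Sum>\<mu>\<in>J. norm (c \<mu>)) \<le> 2 * B"
proof -
  define E where "E = {-1, 0, 1::int}"
  \<comment> \<open>Where \<open>c \<mu> = 0\<close> this is 0, and the corresponding factor of the
    product is constantly 1.\<close>
  define v where "v \<mu> = sgn (c \<mu>)" for \<mu>
  \<comment> \<open>Writing \<open>Re z\<close> as \<open>(z + cnj z) / 2\<close> splits a factor
    into the frequencies \<open>0\<close>, \<open>-\<mu>\<close> and \<open>\<mu>\<close> with these
    weights; the halves are the origin of the constant 2 in the bound.\<close>
  define w where "w \<mu> e = (if e = 0 then 1 else if e = 1 then cnj (v \<mu>) / 2 else v \<mu> / 2)" for \<mu> and e :: int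
  define p where "p \<mu> t = 1 + Re (cnj (v \<mu>) * cis (- (\<mu> * t)))" for \<mu> t
  define P where "P t = (\<Prod>\<mu>\<in>J. p \<mu> t)" for t
  \<comment> \<open>A choice \<open>\<epsilon>\<close> of one summand from every factor contributes
    the frequency \<open>- N \<epsilon>\<close> with weight \<open>W \<epsilon>\<close>.\<close>
  define N where "N \<epsilon> = (\<Sum>\<mu>\<in>J. of_int (\<epsilon> \<mu>) * \<mu>)" for \<epsilon> :: "real \<Rightarrow> int"
  define W where "W \<epsilon> = (\<Prod>\<mu>\<in>J. w \<mu> (\<epsilon> \<mu>))" for \<epsilon>
  define X where "X = (\<Pi>\<^sub>E \<mu>\<in>J. E)"
  have finX: "finite X" unfolding X_def using J(1) by (intro finite_PiE) (auto simp: E_def)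
  have p0: "p \<mu> t \<ge> 0" for \<mu> t
  proof -
    have "norm (cnj (v \<mu>) * cis (- (\<mu> * t))) \<le> 1" by (simp add: norm_mult v_def norm_sgn)
    then show ?thesis using abs_Re_le_cmod[of "cnj (v \<mu>) * cis (- (\<mu> * t))"] unfolding p_def by linarith
  qed
  have P0: "P t \<ge> 0" for t unfolding P_def by (intro prod_nonneg ballI p0)
  have contP: "continuous_on A P" for A unfolding P_def p_def by (intro continuous_intros)
  have factor: "complex_of_real (p \<mu> t) = (\<Sum>e\<in>E. w \<mu> e * cis (- (of_int e * \<mu> * t)))" for \<mu> t
  proof -
    define z where "z = cnj (v \<mu>) * cis (- (\<mu> * t))"
    have "(\<Sum>e\<in>E. w \<mu> e * cis (- (of_int e * \<mu> * t))) = 1 + (z + cnj z) / 2"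
      by (simp add: E_def w_def z_def cis_cnj add_divide_distrib)
    also have "\<dots> = complex_of_real (1 + Re z)" by (simp add: complex_add_cnj)
    also have "1 + Re z = p \<mu> t" by (simp only: p_def z_def)
    finally show ?thesis by simp
  qed
  have expand: "complex_of_real (P t) = (\<Sum>\<epsilon>\<in>X. W \<epsilon> * cis (- (N \<epsilon> * t)))" for t
  proof -
    have "complex_of_real (P t) = (\<Prod>\<mu>\<in>J. \<Sum>e\<in>E. w \<mu> e * cis (- (of_int e * \<mu> * t)))"
      by (simp add: P_def factor)
    also have "\<dots> = (\<Sum>\<epsilon>\<in>X. \<Prod>\<mu>\<in>J. w \<mu> (\<epsilon> \<mu>) * cis (- (of_int (\<epsilon> \<mu>) * \<mu> * t)))"
      unfolding X_def using J(1) by (intro prod_sum_PiE) (auto simp: E_def)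
    also have "\<dots> = (\<Sum>\<epsilon>\<in>X. W \<epsilon> * cis (- (N \<epsilon> * t)))"
      by (simp add: prod.distrib prod_cis W_def N_def sum_distrib_right sum_negf)
    finally show ?thesis .
  qed
  define \<epsilon>0 where "\<epsilon>0 = (\<lambda>\<mu>\<in>J. 0::int)"
  define \<delta> where "\<delta> \<nu> = (\<lambda>\<mu>\<in>J. if \<mu> = \<nu> then 1 else 0::int)" for \<nu>
  have meanP: "has_mean (\<lambda>t. complex_of_real (P t)) 1"
  proof -
    have "has_mean (\<lambda>t. \<Sum>\<epsilon>\<in>X. W \<epsilon> * cis ((- N \<epsilon>) * t)) (\<Sum>\<epsilon>\<in>X. W \<epsilon> * (if - N \<epsilon> = 0 then 1 else 0))"
      by (intro has_mean_sum finX has_mean_cmult has_mean_cis continuous_intros)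
    also have "(\<Sum>\<epsilon>\<in>X. W \<epsilon> * (if - N \<epsilon> = 0 then 1 else 0)) = (\<Sum>\<epsilon>\<in>{\<epsilon>0}. W \<epsilon> * (if - N \<epsilon> = 0 then 1 else 0))"
    proof (rule sum.mono_neutral_right[OF finX])
      show "{\<epsilon>0} \<subseteq> X" by (auto simp: X_def \<epsilon>0_def E_def)
      show "\<forall>\<epsilon>\<in>X - {\<epsilon>0}. W \<epsilon> * (if - N \<epsilon> = 0 then 1 else 0) = 0"
      proof
        fix \<epsilon> assume \<epsilon>: "\<epsilon> \<in> X - {\<epsilon>0}"
        have "N \<epsilon> \<noteq> 0"
        proof
          assume "N \<epsilon> = 0"
          then have "\<epsilon> \<mu> = 0" if "\<mu> \<in> J" for \<mu>
            using rat_independent_int_combination[OF ind J, of \<epsilon> \<mu>] that by (simp add: N_def)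
          then have "\<epsilon> = \<epsilon>0" using \<epsilon> by (auto simp: X_def \<epsilon>0_def PiE_def extensional_def fun_eq_iff)
          with \<epsilon> show False by simp
        qed
        then show "W \<epsilon> * (if - N \<epsilon> = 0 then 1 else 0) = 0" by simp
      qed
    qed
    also have "\<dots> = 1" by (simp add: W_def N_def \<epsilon>0_def w_def)
    finally show ?thesis by (simp add: expand)
  qed
  have meanFP: "has_mean (\<lambda>t. F t * complex_of_real (P t)) (complex_of_real ((\<Sum>\<mu>\<in>J. norm (c \<mu>)) / 2))"
  proof -
    have N\<delta>: "N (\<delta> \<nu>) = \<nu>" if "\<nu> \<in> J" for \<nu>
    proof -
      have "N (\<delta> \<nu>) = (\<Sum>\<mu>\<in>J. if \<mu> = \<nu> then \<mu> else 0)" unfolding N_def \<delta>_def by (intro sum.cong) auto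
      also have "\<dots> = \<nu>" using that J(1) by simp
      finally show ?thesis .
    qed
    have W\<delta>: "W (\<delta> \<nu>) = cnj (v \<nu>) / 2" if "\<nu> \<in> J" for \<nu>
    proof -
      have "W (\<delta> \<nu>) = (\<Prod>\<mu>\<in>J. if \<mu> = \<nu> then cnj (v \<mu>) / 2 else 1)" unfolding W_def \<delta>_def w_def by (intro prod.cong) auto
      also have "\<dots> = cnj (v \<nu>) / 2" using that J(1) by simp
      finally show ?thesis .
    qed
    have "has_mean (\<lambda>t. \<Sum>\<epsilon>\<in>X. W \<epsilon> * (F t * cis (- (N \<epsilon> * t)))) (\<Sum>\<epsilon>\<in>X. W \<epsilon> * c (N \<epsilon>))"
      by (intro has_mean_sum finX has_mean_cmult mean continuous_intros cont)
    also have "(\<lambda>t. \<Sum>\<epsilon>\<in>X. W \<epsilon> * (F t * cis (- (N \<epsilon> * t)))) = (\<lambda>t. F t * complex_of_real (P t))"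
      unfolding expand sum_distrib_left by (simp add: mult_ac)
    also have "(\<Sum>\<epsilon>\<in>X. W \<epsilon> * c (N \<epsilon>)) = (\<Sum>\<epsilon>\<in>\<delta> ` J. W \<epsilon> * c (N \<epsilon>))"
    proof (rule sum.mono_neutral_right[OF finX])
      show "\<delta> ` J \<subseteq> X" by (auto simp: X_def \<delta>_def E_def split: if_splits)
      show "\<forall>\<epsilon>\<in>X - \<delta> ` J. W \<epsilon> * c (N \<epsilon>) = 0"
      proof
        fix \<epsilon> assume \<epsilon>: "\<epsilon> \<in> X - \<delta> ` J"
        have "c (N \<epsilon>) = 0"
        proof (rule ccontr)
          assume "c (N \<epsilon>) \<noteq> 0"
          define \<nu> where "\<nu> = N \<epsilon>"
          have \<nu>S: "\<nu> \<in> S" using \<open>c (N \<epsilon>) \<noteq> 0\<close> zero unfolding \<nu>_def by blast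
          \<comment> \<open>The relation \<open>N \<epsilon> = \<nu>\<close> as an integer
            combination over \<open>insert \<nu> J\<close>, without deciding beforehand whether
            \<open>\<nu>\<close> lies in \<open>J\<close>. Outside \<open>J\<close> its coefficient
            would be \<open>-1\<close>; hence \<open>\<nu> \<in> J\<close>, and the other
            coefficients give \<open>\<epsilon> = \<delta> \<nu>\<close>.\<close>
          define k where "k x = (if x \<in> J then \<epsilon> x else 0) - (if x = \<nu> then 1 else 0)" for x
          have "(\<Sum>x\<in>insert \<nu> J. of_int (k x) * x) = (\<Sum>x\<in>insert \<nu> J. (if x \<in> J then of_int (\<epsilon> x) * x else 0)) - (\<Sum>x\<in>insert \<nu> J. if x = \<nu> then x else 0)"
            unfolding sum_subtractf[symmetric] k_def by (intro sum.cong) (auto simp: algebra_simps)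
          also have "(\<Sum>x\<in>insert \<nu> J. (if x \<in> J then of_int (\<epsilon> x) * x else 0)) = N \<epsilon>"
            unfolding N_def using J(1) by (intro sum.mono_neutral_cong_right) auto
          also have "(\<Sum>x\<in>insert \<nu> J. if x = \<nu> then x else 0) = \<nu>" using J(1) by (subst sum.delta) auto
          finally have "(\<Sum>x\<in>insert \<nu> J. of_int (k x) * x) = 0" by (simp add: \<nu>_def)
          then have k0: "k x = 0" if "x \<in> insert \<nu> J" for x
            using rat_independent_int_combination[OF ind, of "insert \<nu> J" k x] J \<nu>S that by auto
          have "\<nu> \<in> J" using k0[of \<nu>] by (auto simp: k_def split: if_splits)
          moreover have "\<epsilon> = \<delta> \<nu>"
          proof
            fix x show "\<epsilon> x = \<delta> \<nu> x"
              using k0[of x] \<epsilon> by (cases "x \<in> J") (auto simp: k_def \<delta>_def X_def PiE_def extensional_def)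
          qed
          ultimately show False using \<epsilon> by blast
        qed
        then show "W \<epsilon> * c (N \<epsilon>) = 0" by simp
      qed
    qed
    also have "\<dots> = (\<Sum>\<nu>\<in>J. W (\<delta> \<nu>) * c (N (\<delta> \<nu>)))"
      by (subst sum.reindex) (auto intro!: inj_onI, metis N\<delta>)
    also have "\<dots> = (\<Sum>\<nu>\<in>J. complex_of_real (norm (c \<nu>)) / 2)"
    proof (intro sum.cong refl)
      fix \<nu> assume "\<nu> \<in> J"
      have "cnj (v \<nu>) * c \<nu> = complex_of_real (norm (c \<nu>))"
      proof (cases "c \<nu> = 0")
        case False
        have "cnj (v \<nu>) * c \<nu> = (c \<nu> * cnj (c \<nu>)) / norm (c \<nu>)" by (simp add: v_def sgn_eq mult.commute)
        also have "\<dots> = complex_of_real (norm (c \<nu>))"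
          unfolding complex_norm_square[symmetric] using False by (simp add: power2_eq_square)
        finally show ?thesis .
      qed simp
      then show "W (\<delta> \<nu>) * c (N (\<delta> \<nu>)) = complex_of_real (norm (c \<nu>)) / 2"
        using \<open>\<nu> \<in> J\<close> by (simp add: W\<delta> N\<delta>)
    qed
    finally show ?thesis by (simp add: sum_divide_distrib)
  qed
  \<comment> \<open>Nonnegativity of \<open>P\<close> makes the modulus of the kernel the kernel
    itself, so no constant beyond its mean 1 enters.\<close>
  have "norm (complex_of_real ((\<Sum>\<mu>\<in>J. norm (c \<mu>)) / 2)) \<le> B * norm (1::complex)"
  proof (rule tendsto_le[OF trivial_limit_at_top_linorder])
    show "((\<lambda>T. norm (complex_of_real (1 / (2 * T)) * integral {-T..T} (\<lambda>t. F t * complex_of_real (P t)))) \<longlongrightarrow>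
       norm (complex_of_real ((\<Sum>\<mu>\<in>J. norm (c \<mu>)) / 2))) at_top"
      using meanFP unfolding has_mean_def by (rule tendsto_norm)
    show "((\<lambda>T. B * norm (complex_of_real (1 / (2 * T)) * integral {-T..T} (\<lambda>t. complex_of_real (P t)))) \<longlongrightarrow> B * norm (1::complex)) at_top"
      using meanP unfolding has_mean_def by (intro tendsto_intros)
    show "\<forall>\<^sub>F T in at_top. norm (complex_of_real (1 / (2 * T)) * integral {-T..T} (\<lambda>t. F t * complex_of_real (P t)))
       \<le> B * norm (complex_of_real (1 / (2 * T)) * integral {-T..T} (\<lambda>t. complex_of_real (P t)))"
      using eventually_gt_at_top[of 0]
    proof eventually_elim
      case (elim T)
      have iP: "P integrable_on {-T..T}" by (intro integrable_continuous_real contP)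
      have "norm (integral {-T..T} (\<lambda>t. F t * complex_of_real (P t))) \<le> integral {-T..T} (\<lambda>t. B * P t)"
      proof (rule integral_norm_bound_integral)
        show "(\<lambda>t. F t * complex_of_real (P t)) integrable_on {-T..T}"
          by (intro integrable_continuous_real continuous_intros continuous_on_subset[OF cont] contP) auto
        show "(\<lambda>t. B * P t) integrable_on {-T..T}"
          by (intro integrable_continuous_real continuous_intros contP)
        show "norm (F t * complex_of_real (P t)) \<le> B * P t" for t
          using P0[of t] B[of t] by (simp add: norm_mult mult_right_mono)
      qed
      also have "\<dots> = B * integral {-T..T} P" by simp
      also have "integral {-T..T} P \<le> norm (integral {-T..T} (\<lambda>t. complex_of_real (P t)))"
      proof -
        have "integral {-T..T} (\<lambda>t. complex_of_real (P t)) = complex_of_real (integral {-T..T} P)"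
          using has_integral_of_real[OF integrable_integral[OF iP]] by (rule integral_unique)
        then show ?thesis by simp
      qed
      finally have "norm (integral {-T..T} (\<lambda>t. F t * complex_of_real (P t))) \<le> B * norm (integral {-T..T} (\<lambda>t. complex_of_real (P t)))"
        using order.trans[OF norm_ge_zero B] by (simp add: mult_left_mono)
      then have "1 / (2 * T) * norm (integral {-T..T} (\<lambda>t. F t * complex_of_real (P t))) \<le> 1 / (2 * T) * (B * norm (integral {-T..T} (\<lambda>t. complex_of_real (P t))))"
        using elim by (intro mult_left_mono) auto
      with elim show ?case by (simp only: norm_mult norm_of_real) simp
    qed
  qed
  moreover have "norm (complex_of_real ((\<Sum>\<mu>\<in>J. norm (c \<mu>)) / 2)) = (\<Sum>\<mu>\<in>J. norm (c \<mu>)) / 2"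
    by (simp only: norm_of_real) (simp add: sum_nonneg)
  ultimately show ?thesis by simp
qed

text \<open>The M-test makes the partial sums converge uniformly in \<open>t\<close>, and almost
  periodicity and means survive uniform limits. By injectivity on the nonzero terms the index set in
  the mean is empty or a singleton, so the sum over it is the coefficient at \<open>\<mu>\<close>,
  or 0 if there is none.\<close>

lemma exponential_series:
  fixes d :: "nat \<Rightarrow> complex" and lam :: "nat \<Rightarrow> real"
  assumes sum: "summable (\<lambda>n. norm (d n))"
  shows ap_exponential_series: "ap (\<lambda>t. \<Sum>n. d n * cis (lam n * t))"
    and has_mean_exponential_series: "inj_on lam {n. d n \<noteq> 0} \<Longrightarrow>
      has_mean (\<lambda>t. (\<Sum>n. d n * cis (lam n * t)) * cis (- (\<mu> * t))) (sum d {n. d n \<noteq> 0 \<and> lam n = \<mu>})"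
proof -
  have "uniform_limit UNIV (\<lambda>N t. \<Sum>n<N. d n * cis (lam n * t)) (\<lambda>t. \<Sum>n. d n * cis (lam n * t)) sequentially"
    by (rule Weierstrass_m_test[OF _ sum]) (simp add: norm_mult)
  moreover have "ap (\<lambda>t. \<Sum>n<N. d n * cis (lam n * t))" for N
    by (induction N) (simp_all add: ap_const ap_add ap_mult ap_cis)
  ultimately show "ap (\<lambda>t. \<Sum>n. d n * cis (lam n * t))" by (rule ap_uniform_limit[rotated])
  assume inj: "inj_on lam {n. d n \<noteq> 0}"
  define K where "K = {n. d n \<noteq> 0 \<and> lam n = \<mu>}"
  have "finite K"
  proof (rule inj_on_finite)
    show "inj_on lam K" using inj by (rule inj_on_subset) (auto simp: K_def)
    show "lam ` K \<subseteq> {\<mu>}" by (auto simp: K_def)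
  qed simp
  then have "(\<lambda>n. d n * (if lam n - \<mu> = 0 then 1 else 0)) sums (\<Sum>n\<in>K. d n * (if lam n - \<mu> = 0 then 1 else 0))"
    by (intro sums_finite) (auto simp: K_def)
  also have "(\<Sum>n\<in>K. d n * (if lam n - \<mu> = 0 then 1 else 0)) = sum d K"
    by (intro sum.cong) (auto simp: K_def)
  finally have c: "(\<lambda>N. \<Sum>n<N. d n * (if lam n - \<mu> = 0 then 1 else 0)) \<longlonglongrightarrow> sum d K"
    by (simp only: sums_def)
  have lim: "uniform_limit UNIV (\<lambda>N t. \<Sum>n<N. d n * cis ((lam n - \<mu>) * t)) (\<lambda>t. \<Sum>n. d n * cis ((lam n - \<mu>) * t)) sequentially"
    by (rule Weierstrass_m_test[OF _ sum]) (simp add: norm_mult)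
  have "has_mean (\<lambda>t. \<Sum>n. d n * cis ((lam n - \<mu>) * t)) (sum d K)"
  proof (rule has_mean_uniform_limit[OF _ lim _ c])
    show "continuous_on UNIV (\<lambda>t. \<Sum>n<N. d n * cis ((lam n - \<mu>) * t))" for N by (intro continuous_intros)
    show "has_mean (\<lambda>t. \<Sum>n<N. d n * cis ((lam n - \<mu>) * t)) (\<Sum>n<N. d n * (if lam n - \<mu> = 0 then 1 else 0))" for N
      by (intro has_mean_sum has_mean_cmult has_mean_cis continuous_intros finite_lessThan)
  qed
  also have "(\<lambda>t. \<Sum>n. d n * cis ((lam n - \<mu>) * t)) = (\<lambda>t. (\<Sum>n. d n * cis (lam n * t)) * cis (- (\<mu> * t)))"
  proof
    fix t
    have "summable (\<lambda>n. d n * cis (lam n * t))"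
      by (rule summable_norm_cancel) (use sum in \<open>simp add: norm_mult\<close>)
    then have "(\<Sum>n. d n * cis (lam n * t)) * cis (- (\<mu> * t)) = (\<Sum>n. d n * cis (lam n * t) * cis (- (\<mu> * t)))"
      by (rule suminf_mult2)
    also have "\<dots> = (\<Sum>n. d n * cis ((lam n - \<mu>) * t))"
      by (simp add: mult.assoc cis_mult algebra_simps)
    finally show "(\<Sum>n. d n * cis ((lam n - \<mu>) * t)) = (\<Sum>n. d n * cis (lam n * t)) * cis (- (\<mu> * t))" by simp
  qed
  finally show "has_mean (\<lambda>t. (\<Sum>n. d n * cis (lam n * t)) * cis (- (\<mu> * t))) (sum d {n. d n \<noteq> 0 \<and> lam n = \<mu>})"
    unfolding K_def .
qed

section \<open>The Dirichlet series and its sum\<close>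

lemma exp_Complex: "exp (complex_of_real l * Complex \<sigma> t) = exp (of_real (\<sigma> * l)) * cis (l * t)"
  unfolding cis_conv_exp exp_add[symmetric] by (intro arg_cong[of _ _ exp]) (simp add: complex_eq_iff)

locale ap_dirichlet_series =
  fixes \<alpha> \<beta> :: ereal and f :: "complex \<Rightarrow> complex" and I :: "nat set"
    and a :: "nat \<Rightarrow> complex" and lam :: "nat \<Rightarrow> real"
  assumes f: "almost_periodic_strip \<alpha> \<beta> f"
    and series: "is_dirichlet_series \<alpha> \<beta> f I a lam"
    and ind: "rat_real.independent (lam ` I)"
begin

text \<open>Padding by zeros turns sums over \<open>I\<close> into series over all naturals, for
  finite and infinite \<open>I\<close> alike; outside \<open>I\<close> nothing is known about
  \<open>a\<close> and \<open>lam\<close>.\<close>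

definition coef :: "nat \<Rightarrow> complex" where "coef n = (if n \<in> I then a n else 0)"

lemma dirichlet_facts:
  shows dirichlet_inj: "inj_on lam I" and dirichlet_image: "lam ` I = fourier_exponents \<alpha> \<beta> f"
    and dirichlet_coeff: "\<And>n. n \<in> I \<Longrightarrow> a n = fourier_coeff \<alpha> \<beta> f (lam n)"
    and dirichlet_nonzero: "\<And>n. coef n \<noteq> 0 \<longleftrightarrow> n \<in> I"
proof -
  show 1: "inj_on lam I" "lam ` I = fourier_exponents \<alpha> \<beta> f" "\<And>n. n \<in> I \<Longrightarrow> a n = fourier_coeff \<alpha> \<beta> f (lam n)"
    using series by (auto simp: is_dirichlet_series_def bij_betw_def)
  show "coef n \<noteq> 0 \<longleftrightarrow> n \<in> I" for n
  proof (cases "n \<in> I")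
    case True
    then have "lam n \<in> fourier_exponents \<alpha> \<beta> f" using 1(2) by blast
    with True 1(3)[OF True] show ?thesis by (simp add: coef_def fourier_exponents_def)
  qed (simp add: coef_def)
qed

text \<open>The Riesz product bound is independent of the finite set of exponents, so twice a bound
  for \<open>f\<close> on the line bounds every partial sum.\<close>

lemma dirichlet_abs_summable:
  assumes \<sigma>: "\<alpha> < ereal \<sigma>" "ereal \<sigma> < \<beta>"
  shows "summable (\<lambda>n. norm (coef n) * exp (\<sigma> * lam n))"
proof -
  define c where "c \<mu> = fourier_coeff \<alpha> \<beta> f \<mu> * exp (of_real (\<mu> * \<sigma>))" for \<mu>
  obtain B where B: "\<And>t. norm (f (Complex \<sigma> t)) \<le> B" using ap_bounded[OF ap_vertical[OF f \<sigma>]] by blast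
  have c0: "c \<mu> = 0" if "\<mu> \<notin> lam ` I" for \<mu>
    using that unfolding dirichlet_image c_def by (simp add: fourier_exponents_def)
  have "(\<Sum>n<N. norm (coef n) * exp (\<sigma> * lam n)) \<le> 2 * B" for N
  proof -
    define J where "J = {..<N} \<inter> I"
    have "(\<Sum>n<N. norm (coef n) * exp (\<sigma> * lam n)) = (\<Sum>n\<in>J. norm (c (lam n)))"
      by (rule sum.mono_neutral_cong_right)
        (auto simp: J_def coef_def c_def dirichlet_coeff norm_mult mult.commute norm_exp_eq_Re)
    also have "\<dots> = (\<Sum>\<mu>\<in>lam ` J. norm (c \<mu>))"
      using inj_on_subset[OF dirichlet_inj, of J] by (subst sum.reindex) (auto simp: J_def)
    also have "\<dots> \<le> 2 * B"
      by (rule riesz_product_bound[OF continuous_vertical[OF f \<sigma>] B _ ind c0])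
        (use has_mean_vertical[OF f \<sigma>] in \<open>auto simp: c_def J_def\<close>)
    finally show ?thesis .
  qed
  then show ?thesis by (intro summableI_nonneg_bounded[where x = "2 * B"]) auto
qed

lemma dirichlet_summable:
  assumes "s \<in> vstrip \<alpha> \<beta>"
  shows "summable (\<lambda>n. norm (coef n * exp (of_real (lam n) * s)))"
  using dirichlet_abs_summable[of "Re s"] assms by (simp add: vstrip_def norm_mult mult.commute)

lemma dirichlet_sum:
  assumes s: "s \<in> vstrip \<alpha> \<beta>"
  shows "f s = (\<Sum>n. coef n * exp (of_real (lam n) * s))"
proof -
  define \<sigma> where "\<sigma> = Re s"
  have \<sigma>: "\<alpha> < ereal \<sigma>" "ereal \<sigma> < \<beta>" using s by (auto simp: vstrip_def \<sigma>_def)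
  define d where "d n = coef n * exp (of_real (\<sigma> * lam n))" for n
  define G where "G t = (\<Sum>n. d n * cis (lam n * t))" for t
  have G: "G t = (\<Sum>n. coef n * exp (of_real (lam n) * Complex \<sigma> t))" for t
    by (simp only: G_def d_def exp_Complex mult.assoc)
  have sum: "summable (\<lambda>n. norm (d n))" using dirichlet_abs_summable[OF \<sigma>] by (simp add: d_def norm_mult)
  have dnz: "d n \<noteq> 0 \<longleftrightarrow> n \<in> I" for n by (simp add: d_def dirichlet_nonzero)
  have apG: "ap G" unfolding G_def by (rule ap_exponential_series[OF sum])
  have meanG: "has_mean (\<lambda>t. G t * cis (- (\<mu> * t))) (fourier_coeff \<alpha> \<beta> f \<mu> * exp (of_real (\<mu> * \<sigma>)))" for \<mu>
  proof -
    have "has_mean (\<lambda>t. G t * cis (- (\<mu> * t))) (sum d {n. d n \<noteq> 0 \<and> lam n = \<mu>})"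
      unfolding G_def using has_mean_exponential_series[OF sum] dirichlet_inj by (simp add: dnz)
    \<comment> \<open>At most one index carries the exponent \<open>\<mu>\<close>; if there is none,
      \<open>\<mu>\<close> is not a Fourier exponent and both sides vanish.\<close>
    also have "sum d {n. d n \<noteq> 0 \<and> lam n = \<mu>} = fourier_coeff \<alpha> \<beta> f \<mu> * exp (of_real (\<mu> * \<sigma>))"
    proof (cases "\<mu> \<in> lam ` I")
      case True
      then obtain k where k: "k \<in> I" "\<mu> = lam k" by blast
      then have "{n. d n \<noteq> 0 \<and> lam n = \<mu>} = {k}" using dirichlet_inj by (auto simp: dnz inj_on_def)
      then show ?thesis using k by (simp add: d_def coef_def dirichlet_coeff mult.commute)
    next
      case False
      then have *: "{n. d n \<noteq> 0 \<and> lam n = \<mu>} = {}" by (auto simp: dnz)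
      have "fourier_coeff \<alpha> \<beta> f \<mu> = 0" using False unfolding dirichlet_image by (simp add: fourier_exponents_def)
      then show ?thesis unfolding * by simp
    qed
    finally show ?thesis .
  qed
  have apF: "ap (\<lambda>t. f (Complex \<sigma> t))" by (rule ap_vertical[OF f \<sigma>])
  have "f (Complex \<sigma> t) - G t = 0" for t
  proof (rule ap_uniqueness)
    show "ap (\<lambda>t. f (Complex \<sigma> t) - G t)"
      using ap_add[OF apF ap_mult[OF ap_const[of "-1"] apG]] by simp
    fix \<mu>
    have "has_mean (\<lambda>t. f (Complex \<sigma> t) * cis (- (\<mu> * t)) - G t * cis (- (\<mu> * t)))
        (fourier_coeff \<alpha> \<beta> f \<mu> * exp (of_real (\<mu> * \<sigma>)) - fourier_coeff \<alpha> \<beta> f \<mu> * exp (of_real (\<mu> * \<sigma>)))"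
      by (intro has_mean_diff has_mean_vertical[OF f \<sigma>] meanG continuous_intros ap_continuous apF apG)
    then show "has_mean (\<lambda>t. (f (Complex \<sigma> t) - G t) * cis (- (\<mu> * t))) 0" by (simp add: left_diff_distrib)
  qed
  then have "f (Complex \<sigma> (Im s)) = G (Im s)" by simp
  then show ?thesis unfolding G \<sigma>_def by simp
qed

end

section \<open>Phases\<close>

text \<open>As \<open>\<theta>\<close> runs from 0 to \<open>pi\<close>, the length of
  \<open>A + B * cis \<theta>\<close> moves continuously from \<open>A + B\<close> down to
  \<open>\<bar>A - B\<bar>\<close>. The triangle inequalities place \<open>C\<close> between these
  values, and \<open>v\<close> is the direction that closes the triangle.\<close>

lemma triangle_phases:
  fixes A B C :: real
  assumes "A \<ge> 0" "B \<ge> 0" "C \<ge> 0" "A \<le> B + C" "B \<le> A + C" "C \<le> A + B"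
  obtains u v :: complex where "norm u = 1" "norm v = 1" "of_real A + of_real B * u + of_real C * v = 0"
proof -
  define \<phi> where "\<phi> \<theta> = norm (of_real A + of_real B * cis \<theta>)" for \<theta>
  have "\<exists>\<theta>\<ge>0. \<theta> \<le> pi \<and> \<phi> \<theta> = C"
  proof (rule IVT2')
    have "of_real A + of_real B * cis pi = complex_of_real (A - B)" by (simp add: cis_pi)
    then have "\<phi> pi = \<bar>A - B\<bar>" unfolding \<phi>_def by (simp only: norm_of_real)
    then show "\<phi> pi \<le> C" using assms by simp
    have "of_real A + of_real B * cis 0 = complex_of_real (A + B)" by simp
    then have "\<phi> 0 = \<bar>A + B\<bar>" unfolding \<phi>_def by (simp only: norm_of_real)
    then show "C \<le> \<phi> 0" using assms by simp
    show "continuous_on {0..pi} \<phi>" unfolding \<phi>_def by (intro continuous_intros)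
  qed simp
  then obtain \<theta> where \<theta>: "\<phi> \<theta> = C" by blast
  show thesis
  proof (cases "C = 0")
    case True
    then show ?thesis using \<theta> that[of "cis \<theta>" 1] by (simp add: \<phi>_def)
  next
    case False
    define v where "v = (of_real A + of_real B * cis \<theta>) / of_real (- C)"
    have "norm v = 1" using \<theta> False assms(3) unfolding v_def norm_divide norm_of_real \<phi>_def by simp
    moreover have "of_real A + of_real B * cis \<theta> + of_real C * v = 0" using False by (simp add: v_def)
    ultimately show ?thesis using that[of "cis \<theta>" v] by simp
  qed
qed

text \<open>Grouping the terms as a prefix, a single term and a suffix, with the single term straddling
  half of the sum, reduces the closing of an infinite polygon to that of a triangle.\<close>

lemma polygon_phases:
  fixes r :: "nat \<Rightarrow> real"
  assumes nonneg: "\<And>i. r i \<ge> 0" and sum: "summable r" and half: "\<And>i. 2 * r i \<le> suminf r"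
  obtains z :: "nat \<Rightarrow> complex" where "\<And>i. norm (z i) = 1" "(\<lambda>i. of_real (r i) * z i) sums 0"
proof (cases "suminf r = 0")
  case True
  then have "r i = 0" for i using half[of i] nonneg[of i] by simp
  then show ?thesis using that[of "\<lambda>_. 1"] by simp
next
  case False
  define S where "S = suminf r"
  have S: "S > 0" using False suminf_nonneg[OF sum nonneg] by (simp add: S_def)
  have "(\<lambda>n. \<Sum>i<n. r i) \<longlonglongrightarrow> S" using summable_LIMSEQ[OF sum] by (simp add: S_def)
  then have "\<forall>\<^sub>F n in sequentially. (\<Sum>i<n. r i) > S / 2" using S by (intro order_tendstoD(1)) auto
  then have ex: "\<exists>n. (\<Sum>i<n. r i) > S / 2" by (auto simp: eventually_sequentially)
  \<comment> \<open>The partial sums cross \<open>S / 2\<close> at the term with index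
    \<open>n = m - 1\<close>. So the prefix \<open>A\<close> and the suffix \<open>C\<close> are at
    most \<open>S / 2\<close>, as is \<open>r n\<close> by hypothesis; for three numbers with sum
    \<open>S\<close> these bounds are the triangle inequalities.\<close>
  define m where "m = (LEAST n. (\<Sum>i<n. r i) > S / 2)"
  have m: "(\<Sum>i<m. r i) > S / 2" unfolding m_def using ex by (rule LeastI_ex)
  then obtain n where n: "m = Suc n" using S by (cases m) auto
  define A where "A = (\<Sum>i<n. r i)"
  have A: "A \<le> S / 2" using not_less_Least[of n "\<lambda>n. (\<Sum>i<n. r i) > S / 2"] n unfolding m_def A_def by simp
  have ABS: "A + r n > S / 2" using m n by (simp add: A_def)
  define C where "C = S - (A + r n)"
  have "A \<ge> 0" unfolding A_def by (intro sum_nonneg nonneg)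
  have C: "C = (\<Sum>i. r (i + Suc n))" using suminf_split_initial_segment[OF sum, of "Suc n"] by (simp add: C_def A_def S_def)
  have "C \<ge> 0" unfolding C using summable_ignore_initial_segment[OF sum, of "Suc n"] by (rule suminf_nonneg) (rule nonneg)
  obtain u v :: complex where uv: "norm u = 1" "norm v = 1" "of_real A + of_real (r n) * u + of_real C * v = 0"
    by (rule triangle_phases[of A "r n" C]) (use A ABS \<open>A \<ge> 0\<close> \<open>C \<ge> 0\<close> nonneg[of n] half[of n] in \<open>auto simp: C_def S_def\<close>)
  define z where "z i = (if i < n then 1 else if i = n then u else v)" for i
  have "(\<lambda>i. of_real (r (i + Suc n)) * v) sums (of_real C * v)"
    using summable_sums[OF summable_ignore_initial_segment[OF sum, of "Suc n"]] unfolding C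
    by (intro sums_mult2 sums_of_real) 
  then have "(\<lambda>i. of_real (r (i + Suc n)) * z (i + Suc n)) sums (of_real C * v)" by (simp add: z_def)
  then have "(\<lambda>i. of_real (r i) * z i) sums (of_real C * v + (\<Sum>i<Suc n. of_real (r i) * z i))"
    by (subst (asm) sums_iff_shift)
  moreover have "(\<Sum>i<Suc n. of_real (r i) * z i) = of_real A + of_real (r n) * u"
    by (simp add: z_def A_def)
  ultimately have "(\<lambda>i. of_real (r i) * z i) sums 0" using uv(3) by (simp add: add.commute)
  moreover have "norm (z i) = 1" for i using uv by (simp add: z_def)
  ultimately show ?thesis using that by blast
qed

text \<open>Kronecker's theorem concerns fractional parts and independence over the integers. Angles
  are therefore divided by \<open>2 * pi\<close>, and rational independence is specialised to
  integer coefficients; bounding the chord by the arc converts the accuracy back to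
  \<open>\<epsilon>\<close>.\<close>

lemma kronecker_phases:
  fixes lam :: "nat \<Rightarrow> real" and \<phi> :: "nat \<Rightarrow> real"
  assumes ind: "rat_real.independent (lam ` I)" and inj: "inj_on lam I" and J: "finite J" "J \<subseteq> I" and "\<epsilon> > 0"
  obtains t where "\<And>i. i \<in> J \<Longrightarrow> norm (cis (lam i * t) - cis (\<phi> i)) \<le> \<epsilon>"
proof -
  obtain e :: "nat \<Rightarrow> nat" where e: "bij_betw e {..<card J} J"
    using ex_bij_betw_nat_finite[OF J(1)] by (auto simp: atLeast0LessThan)
  have img: "(\<lambda>k. lam (e k)) ` {..<card J} = lam ` J"
    using e by (simp add: bij_betw_def image_image[symmetric])
  interpret intmod: Modules.module "(\<lambda>r. (*) (real_of_int r))"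
    by (simp add: Modules.module.intro distrib_left mult.commute)
  have "module.independent (\<lambda>r. (*) (real_of_int r)) ((\<lambda>k. lam (e k)) ` {..<card J})"
    unfolding img intmod.independent_explicit_module
  proof (intro allI impI)
    fix t u v assume "finite t" "t \<subseteq> lam ` J" "(\<Sum>v\<in>t. real_of_int (u v) * v) = 0" "v \<in> t"
    then show "u v = 0" using J(2) by (intro rat_independent_int_combination[OF ind]) auto
  qed
  moreover have "inj_on (\<lambda>k. lam (e k)) {..<card J}"
    using comp_inj_on[of e "{..<card J}" lam] e inj_on_subset[OF inj J(2)] by (auto simp: bij_betw_def o_def)
  ultimately obtain t h where th: "\<And>k. k < card J \<Longrightarrow> \<bar>t * lam (e k) - of_int (h k) - \<phi> (e k) / (2 * pi)\<bar> < \<epsilon> / (2 * pi)"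
    using Kronecker_thm_1[of "\<lambda>k. lam (e k)" "card J" "\<epsilon> / (2 * pi)" "\<lambda>k. \<phi> (e k) / (2 * pi)"] \<open>\<epsilon> > 0\<close> by auto
  show ?thesis
  proof (rule that[of "2 * pi * t"])
    fix i assume "i \<in> J"
    then obtain k where k: "k < card J" "i = e k" using e by (auto simp: bij_betw_def)
    have "cis (\<phi> i) = cis (\<phi> i) * cis (2 * pi * of_int (h k))" by simp
    also have "\<dots> = cis (\<phi> i + 2 * pi * of_int (h k))" by (simp only: cis_mult)
    finally have "norm (cis (lam i * (2 * pi * t)) - cis (\<phi> i)) \<le> \<bar>lam i * (2 * pi * t) - (\<phi> i + 2 * pi * of_int (h k))\<bar>"
      using norm_cis_diff_le by metis
    also have "lam i * (2 * pi * t) - (\<phi> i + 2 * pi * of_int (h k)) = 2 * pi * (t * lam (e k) - of_int (h k) - \<phi> (e k) / (2 * pi))"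
      using k(2) by (simp add: field_simps)
    also have "\<bar>\<dots>\<bar> \<le> 2 * pi * (\<epsilon> / (2 * pi))"
      using th[OF k(1)] unfolding abs_mult by (intro mult_mono) auto
    finally show "norm (cis (lam i * (2 * pi * t)) - cis (\<phi> i)) \<le> \<epsilon>" by simp
  qed
qed

section \<open>Abscissae of zeros\<close>

text \<open>The criterion is stated with extended nonnegative sums over index sets; this carries
  them over to real series with zeros in the omitted places.\<close>

lemma infsum_ennreal_eq_suminf:
  fixes r :: "nat \<Rightarrow> real"
  assumes nonneg: "\<And>i. r i \<ge> 0" and sum: "summable r"
  shows "(\<Sum>\<^sub>\<infinity>i\<in>D. ennreal (r i)) = ennreal (\<Sum>i. if i \<in> D then r i else 0)"
proof -
  define q where "q i = (if i \<in> D then r i else 0)" for i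
  have q: "q i \<ge> 0" for i by (simp add: q_def nonneg)
  have "summable q" by (rule summable_comparison_test'[OF sum, of 0]) (simp add: q_def nonneg)
  then have "(q has_sum suminf q) UNIV"
    using q by (intro norm_summable_imp_has_sum summable_sums) simp_all
  then have "((\<lambda>F. ennreal (sum q F)) \<longlongrightarrow> ennreal (suminf q)) (finite_subsets_at_top UNIV)"
    unfolding has_sum_def by (rule tendsto_ennrealI)
  moreover have "sum (\<lambda>i. ennreal (q i)) = (\<lambda>F. ennreal (sum q F))"
    by (rule ext) (simp add: q sum_ennreal)
  ultimately have "((\<lambda>i. ennreal (q i)) has_sum ennreal (suminf q)) UNIV"
    unfolding has_sum_def by simp
  then have "(\<Sum>\<^sub>\<infinity>i\<in>UNIV. ennreal (q i)) = ennreal (suminf q)" by (rule infsumI)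
  moreover have "(\<Sum>\<^sub>\<infinity>i\<in>D. ennreal (r i)) = (\<Sum>\<^sub>\<infinity>i\<in>UNIV. ennreal (q i))"
    by (rule infsum_cong_neutral) (auto simp: q_def)
  ultimately show ?thesis by (simp add: q_def[abs_def])
qed

lemma suminf_remove:
  fixes r :: "nat \<Rightarrow> 'a::real_normed_vector"
  assumes "summable r"
  shows "(\<lambda>i. if i = j then 0 else r i) sums (suminf r - r j)"
proof -
  have "(\<lambda>i. r i - (if i = j then r i else 0)) sums (suminf r - r j)"
    by (intro sums_diff summable_sums assms sums_single)
  also have "(\<lambda>i. r i - (if i = j then r i else 0)) = (\<lambda>i. if i = j then 0 else r i)" by auto
  finally show ?thesis .
qed

text \<open>In a vanishing series each term is minus the sum of the others, so its modulus is at
  most the sum of theirs; adding the term to both sides gives the factor 2.\<close>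

lemma term_le_rest_of_zero_sum:
  fixes x :: "nat \<Rightarrow> complex"
  assumes sum: "summable (\<lambda>n. norm (x n))" and zero: "suminf x = 0"
  shows "2 * norm (x j) \<le> (\<Sum>n. norm (x n))"
proof -
  define y where "y n = (if n = j then 0 else x n)" for n
  have ny: "(\<lambda>n. norm (y n)) = (\<lambda>n. if n = j then 0 else norm (x n))" by (auto simp: y_def)
  have "y sums (0 - x j)" using suminf_remove[OF summable_norm_cancel[OF sum], of j] zero by (simp add: y_def[abs_def])
  then have "norm (x j) = norm (suminf y)" by (simp add: sums_iff)
  also have "\<dots> \<le> (\<Sum>n. norm (y n))"
    by (rule summable_norm) (use suminf_remove[OF sum, of j] in \<open>simp add: ny sums_iff\<close>)
  also have "\<dots> = (\<Sum>n. norm (x n)) - norm (x j)" using suminf_remove[OF sum, of j] unfolding ny by (simp add: sums_iff)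
  finally show ?thesis by simp
qed

text \<open>Monotonicity in \<open>\<sigma>\<close> has a direction depending on the sign of
  \<open>l\<close>; the sum of both end values serves either sign.\<close>

lemma exp_between_le:
  fixes u v \<sigma> l :: real
  assumes "u \<le> \<sigma>" "\<sigma> \<le> v"
  shows "exp (\<sigma> * l) \<le> exp (u * l) + exp (v * l)"
proof (cases "l \<ge> 0")
  case True
  then have "exp (\<sigma> * l) \<le> exp (v * l)" using assms by (simp add: mult_right_mono)
  then show ?thesis by (simp add: add_increasing)
next
  case False
  then have "exp (\<sigma> * l) \<le> exp (u * l)" using assms by (simp add: mult_right_mono_neg)
  then show ?thesis by (simp add: add_increasing2)
qed

context ap_dirichlet_series
begin

text \<open>Exponents of both signs may be present, so neither end abscissa alone dominates the
  interval between them. Their sum is one summable majorant for all \<open>\<sigma>\<close> in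
  it.\<close>

lemma dirichlet_majorant:
  assumes "\<alpha> < ereal u" "u \<le> v" "ereal v < \<beta>"
  shows "summable (\<lambda>n. norm (coef n) * (exp (u * lam n) + exp (v * lam n)))"
    and "\<And>\<sigma> n. u \<le> \<sigma> \<Longrightarrow> \<sigma> \<le> v \<Longrightarrow> norm (coef n) * exp (\<sigma> * lam n) \<le> norm (coef n) * (exp (u * lam n) + exp (v * lam n))"
proof -
  have "ereal u < \<beta>" "\<alpha> < ereal v" using between_in_strip[OF assms(1,3)] assms(2) by auto
  then show "summable (\<lambda>n. norm (coef n) * (exp (u * lam n) + exp (v * lam n)))"
    unfolding distrib_left using assms by (intro summable_add dirichlet_abs_summable)
qed (intro mult_left_mono exp_between_le norm_ge_zero)

lemma continuous_on_abs_sum: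
  assumes "\<alpha> < ereal u" "u \<le> v" "ereal v < \<beta>"
  shows "continuous_on {u..v} (\<lambda>\<sigma>. \<Sum>n. norm (coef n) * exp (\<sigma> * lam n))"
proof (rule uniform_limit_theorem)
  show "uniform_limit {u..v} (\<lambda>N \<sigma>. \<Sum>n<N. norm (coef n) * exp (\<sigma> * lam n)) (\<lambda>\<sigma>. \<Sum>n. norm (coef n) * exp (\<sigma> * lam n)) sequentially"
    by (rule Weierstrass_m_test[OF _ dirichlet_majorant(1)[OF assms]]) (use dirichlet_majorant(2)[OF assms] in auto)
qed (auto intro!: always_eventually continuous_intros)

lemma dominant_term_not_zero_abscissa:
  assumes \<sigma>: "\<alpha> < ereal \<sigma>\<^sub>0" "ereal \<sigma>\<^sub>0 < \<beta>"
    and dom: "2 * (norm (coef j) * exp (\<sigma>\<^sub>0 * lam j)) > (\<Sum>n. norm (coef n) * exp (\<sigma>\<^sub>0 * lam n))"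
  shows "\<sigma>\<^sub>0 \<notin> zero_abscissae \<alpha> \<beta> f"
proof
  assume "\<sigma>\<^sub>0 \<in> zero_abscissae \<alpha> \<beta> f"
  then have cl: "\<sigma>\<^sub>0 \<in> closure (Re ` {s \<in> vstrip \<alpha> \<beta>. f s = 0})" by (simp add: zero_abscissae_def)
  obtain \<delta> where \<delta>: "\<delta> > 0" "\<alpha> < ereal (\<sigma>\<^sub>0 - \<delta>)" "ereal (\<sigma>\<^sub>0 + \<delta>) < \<beta>" using strip_inner_interval[OF \<sigma>] .
  define \<phi> where "\<phi> \<sigma> = 2 * (norm (coef j) * exp (\<sigma> * lam j)) - (\<Sum>n. norm (coef n) * exp (\<sigma> * lam n))" for \<sigma>
  have "continuous_on {\<sigma>\<^sub>0 - \<delta>..\<sigma>\<^sub>0 + \<delta>} \<phi>"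
    unfolding \<phi>_def by (intro continuous_intros continuous_on_abs_sum) (use \<delta> in auto)
  then have "isCont \<phi> \<sigma>\<^sub>0" using \<delta>(1) by (intro continuous_on_interior) auto
  moreover have "\<phi> \<sigma>\<^sub>0 > 0" using dom by (simp add: \<phi>_def)
  \<comment> \<open>The tolerance is the value \<open>\<phi> \<sigma>\<^sub>0\<close> itself, which
    keeps \<open>\<phi>\<close> positive near \<open>\<sigma>\<^sub>0\<close>.\<close>
  ultimately obtain \<eta> where \<eta>: "\<eta> > 0" "\<And>\<sigma>. dist \<sigma> \<sigma>\<^sub>0 < \<eta> \<Longrightarrow> dist (\<phi> \<sigma>) (\<phi> \<sigma>\<^sub>0) < \<phi> \<sigma>\<^sub>0"
    unfolding continuous_at_eps_delta by blast
  obtain s where s: "s \<in> vstrip \<alpha> \<beta>" "f s = 0" "dist (Re s) \<sigma>\<^sub>0 < \<eta>"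
    using cl \<eta>(1) unfolding closure_approachable by blast
  have "2 * norm (coef j * exp (of_real (lam j) * s)) \<le> (\<Sum>n. norm (coef n * exp (of_real (lam n) * s)))"
    using term_le_rest_of_zero_sum[OF dirichlet_summable[OF s(1)]] dirichlet_sum[OF s(1)] s(2) by simp
  then have "\<phi> (Re s) \<le> 0" by (simp add: \<phi>_def norm_mult mult.commute)
  then show False using \<eta>(2)[OF s(3)] by (simp add: dist_real_def)
qed

lemma balanced_terms_zero_abscissa:
  assumes \<sigma>: "\<alpha> < ereal \<sigma>\<^sub>0" "ereal \<sigma>\<^sub>0 < \<beta>" and "I \<noteq> {}"
    and bal: "\<And>j. 2 * (norm (coef j) * exp (\<sigma>\<^sub>0 * lam j)) \<le> (\<Sum>n. norm (coef n) * exp (\<sigma>\<^sub>0 * lam n))"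
  shows "\<sigma>\<^sub>0 \<in> zero_abscissae \<alpha> \<beta> f"
proof (rule ccontr)
  assume "\<sigma>\<^sub>0 \<notin> zero_abscissae \<alpha> \<beta> f"
  then have "\<sigma>\<^sub>0 \<notin> closure (Re ` {s \<in> vstrip \<alpha> \<beta>. f s = 0})" using \<sigma> by (simp add: zero_abscissae_def)
  then obtain e where e: "e > 0" "\<And>s. s \<in> vstrip \<alpha> \<beta> \<Longrightarrow> f s = 0 \<Longrightarrow> dist (Re s) \<sigma>\<^sub>0 \<ge> e"
    unfolding closure_approachable by (auto simp: not_less)
  obtain \<delta> where \<delta>: "\<delta> > 0" "\<alpha> < ereal (\<sigma>\<^sub>0 - \<delta>)" "ereal (\<sigma>\<^sub>0 + \<delta>) < \<beta>" using strip_inner_interval[OF \<sigma>] .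
  \<comment> \<open>Vertical translation preserves real parts, so no translate of \<open>f\<close>
    has a zero in this strip; \<open>\<delta>\<close> keeps it inside the domain.\<close>
  define S where "S = vstrip (ereal (\<sigma>\<^sub>0 - min e \<delta>)) (ereal (\<sigma>\<^sub>0 + min e \<delta>))"
  have S: "\<sigma>\<^sub>0 - \<delta> \<le> Re s" "Re s \<le> \<sigma>\<^sub>0 + \<delta>" "dist (Re s) \<sigma>\<^sub>0 < e" if "s \<in> S" for s
    using that by (auto simp: S_def vstrip_def dist_real_def)
  have inS: "Complex \<sigma>\<^sub>0 t \<in> S" for t using \<delta>(1) e(1) by (simp add: S_def vstrip_def)
  have SU: "s + \<i> * of_real t \<in> vstrip \<alpha> \<beta>" if "s \<in> S" for s t
    using between_in_strip[OF \<delta>(2,3) S(1,2)[OF that]] by (simp add: vstrip_def)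
  obtain z :: "nat \<Rightarrow> complex" where z: "\<And>i. norm (z i) = 1" "(\<lambda>i. of_real (norm (coef i) * exp (\<sigma>\<^sub>0 * lam i)) * z i) sums 0"
    using polygon_phases[OF _ dirichlet_abs_summable[OF \<sigma>] bal] by auto
  \<comment> \<open>Dividing by \<open>sgn (coef i)\<close> cancels the argument of the coefficient,
    so that the rotated coefficient points in the direction \<open>z i\<close>; a zero coefficient
    admits any phase.\<close>
  define \<phi> where "\<phi> i = Arg (z i / sgn (coef i))" for i
  have \<phi>: "coef i * cis (\<phi> i) = of_real (norm (coef i)) * z i" for i
  proof (cases "coef i = 0")
    case False
    then have "norm (z i / sgn (coef i)) = 1" by (simp add: norm_divide z(1) norm_sgn)
    then have "cis (\<phi> i) = z i / sgn (coef i)" unfolding \<phi>_def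
      by (subst cis_Arg) (auto simp: sgn_eq)
    with False show ?thesis by (simp add: sgn_eq)
  qed simp
  \<comment> \<open>The accuracy improves together with the number of controlled exponents, so every
    fixed phase converges as \<open>n\<close> grows.\<close>
  have "\<exists>t. \<forall>i\<in>I \<inter> {..<n}. norm (cis (lam i * t) - cis (\<phi> i)) \<le> inverse (real (Suc n))" for n
  proof -
    obtain t where "\<And>i. i \<in> I \<inter> {..<n} \<Longrightarrow> norm (cis (lam i * t) - cis (\<phi> i)) \<le> inverse (real (Suc n))"
      by (rule kronecker_phases[OF ind dirichlet_inj, where J = "I \<inter> {..<n}" and \<epsilon> = "inverse (real (Suc n))" and \<phi> = \<phi>]) auto
    then show ?thesis by blast
  qed
  then obtain t where t: "\<And>n i. i \<in> I \<Longrightarrow> i < n \<Longrightarrow> norm (cis (lam i * t n) - cis (\<phi> i)) \<le> inverse (real (Suc n))"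
    by (metis IntI lessThan_iff)
  define F where "F n s = f (s + \<i> * of_real (t n))" for n s
  define g where "g s = (\<Sum>k. coef k * cis (\<phi> k) * exp (of_real (lam k) * s))" for s
  define R where "R k = norm (coef k) * (exp ((\<sigma>\<^sub>0 - \<delta>) * lam k) + exp ((\<sigma>\<^sub>0 + \<delta>) * lam k))" for k
  \<comment> \<open>\<open>W n\<close> bounds the distance between the translate \<open>F n\<close>
    and \<open>g\<close> on all of \<open>S\<close>. The phases converge only one by one; the
    summable majorant \<open>R k * 2\<close> permits the limit under the sum.\<close>
  define W where "W n = (\<Sum>k. R k * norm (cis (lam k * t n) - cis (\<phi> k)))" for n
  have R: "summable R" "\<And>k s. s \<in> S \<Longrightarrow> norm (coef k * exp (of_real (lam k) * s)) \<le> R k"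
    using dirichlet_majorant[OF \<delta>(2) _ \<delta>(3)] \<delta>(1) S unfolding R_def by (auto simp: norm_mult mult.commute)
  have R0: "R k \<ge> 0" for k unfolding R_def by simp
  have cis2: "norm (cis x - cis y) \<le> 2" for x y using norm_triangle_ineq4[of "cis x" "cis y"] by simp
  have W: "W \<longlonglongrightarrow> 0"
  proof -
    have "(\<lambda>n. R k * norm (cis (lam k * t n) - cis (\<phi> k))) \<longlonglongrightarrow> 0" for k
    proof (cases "k \<in> I")
      case True
      have "\<forall>\<^sub>F n in sequentially. norm (cis (lam k * t n) - cis (\<phi> k)) \<le> inverse (real (Suc n))"
        using eventually_gt_at_top[of k] by eventually_elim (use t True in auto)
      from Lim_null_comparison[OF this LIMSEQ_inverse_real_of_nat]
      show ?thesis by (intro tendsto_mult_right_zero tendsto_norm_zero)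
    next
      case False
      then show ?thesis by (simp add: R_def coef_def)
    qed
    then have "(\<lambda>n. \<Sum>k. R k * norm (cis (lam k * t n) - cis (\<phi> k))) \<longlonglongrightarrow> (\<Sum>k. 0)"
      by (intro tannerys_theorem[where M = "\<lambda>k. R k * 2", THEN conjunct2, THEN conjunct2])
        (auto intro!: always_eventually summable_mult2 R(1) mult_left_mono cis2 R0 simp: abs_mult R0)
    then show ?thesis by (simp add: W_def[abs_def])
  qed
  have summ: "summable (\<lambda>k. coef k * c k * exp (of_real (lam k) * s))" if "s \<in> S" "\<And>k. norm (c k) = 1" for s and c :: "nat \<Rightarrow> complex"
    by (rule summable_comparison_test'[OF R(1), of 0]) (use R(2)[OF that(1)] that(2) in \<open>simp add: norm_mult\<close>)
  have FW: "norm (F n s - g s) \<le> W n" if "s \<in> S" for n s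
  proof -
    have "F n s = (\<Sum>k. coef k * cis (lam k * t n) * exp (of_real (lam k) * s))"
    proof -
      have "exp (of_real (lam k) * (s + \<i> * of_real (t n))) = cis (lam k * t n) * exp (of_real (lam k) * s)" for k
        by (simp add: cis_conv_exp algebra_simps flip: exp_add)
      then show ?thesis unfolding F_def dirichlet_sum[OF SU[OF that]] by (simp add: mult.assoc)
    qed
    then have "F n s - g s = (\<Sum>k. coef k * cis (lam k * t n) * exp (of_real (lam k) * s) - coef k * cis (\<phi> k) * exp (of_real (lam k) * s))"
      unfolding g_def by (simp add: suminf_diff summ[OF that])
    also have "\<dots> = (\<Sum>k. (coef k * exp (of_real (lam k) * s)) * (cis (lam k * t n) - cis (\<phi> k)))"
      by (simp add: algebra_simps)
    also have "norm \<dots> \<le> W n"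
      unfolding W_def
    proof (rule norm_suminf_le)
      show "norm ((coef k * exp (of_real (lam k) * s)) * (cis (lam k * t n) - cis (\<phi> k))) \<le> R k * norm (cis (lam k * t n) - cis (\<phi> k))" for k
        unfolding norm_mult[of "coef k * _"] by (intro mult_right_mono R(2)[OF that]) auto
      show "summable (\<lambda>k. R k * norm (cis (lam k * t n) - cis (\<phi> k)))"
        by (rule summable_comparison_test'[OF summable_mult2[OF R(1), of 2], of 0]) (auto simp: abs_mult R0 intro!: mult_left_mono cis2)
    qed
    finally show ?thesis .
  qed
  have lim: "uniform_limit S F g sequentially"
  proof (rule uniform_limitI)
    fix \<epsilon> :: real assume "\<epsilon> > 0"
    then have "\<forall>\<^sub>F n in sequentially. W n < \<epsilon>" using order_tendstoD(2)[OF W] by blast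
    then show "\<forall>\<^sub>F n in sequentially. \<forall>x\<in>S. dist (F n x) (g x) < \<epsilon>"
      by eventually_elim (auto simp: dist_norm intro: le_less_trans[OF FW])
  qed
  have openS: "open S" unfolding S_def by (rule open_vstrip)
  have connS: "connected S" unfolding S_def by (intro convex_connected convex_vstrip)
  have holF: "F n holomorphic_on S" for n
  proof -
    have "f holomorphic_on vstrip \<alpha> \<beta>"
      using f unfolding almost_periodic_strip_def by (blast intro: analytic_imp_holomorphic)
    then have "f \<circ> (\<lambda>s. s + \<i> * of_real (t n)) holomorphic_on S"
      by (rule holomorphic_on_compose_gen[rotated]) (use SU in \<open>auto intro!: holomorphic_intros\<close>)
    then show ?thesis by (simp add: F_def[abs_def] o_def)
  qed
  have holg: "g holomorphic_on S"
  proof (rule holomorphic_uniform_sequence[OF openS holF])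
    fix x assume "x \<in> S"
    then obtain d where "d > 0" "cball x d \<subseteq> S" using openS open_contains_cball by blast
    then show "\<exists>d>0. cball x d \<subseteq> S \<and> uniform_limit (cball x d) F g sequentially"
      using uniform_limit_on_subset[OF lim] by blast
  qed
  have g0: "g (Complex \<sigma>\<^sub>0 0) = 0"
  proof -
    have "coef k * cis (\<phi> k) * exp (of_real (lam k) * Complex \<sigma>\<^sub>0 0) = of_real (norm (coef k) * exp (\<sigma>\<^sub>0 * lam k)) * z k" for k
      unfolding \<phi> exp_Complex exp_of_real by (simp add: mult_ac)
    then show ?thesis unfolding g_def using z(2) by (simp add: sums_iff)
  qed
  \<comment> \<open>Hurwitz's theorem needs a nonconstant limit. A constant \<open>g\<close> would
    vanish on the line through \<open>\<sigma>\<^sub>0\<close>, and so would its mean against the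
    frequency \<open>lam j\<close>; but that mean is the nonzero coefficient
    \<open>d j\<close>.\<close>
  have "\<not> g constant_on S"
  proof
    assume "g constant_on S"
    then have g_zero: "g (Complex \<sigma>\<^sub>0 s) = 0" for s using inS g0 unfolding constant_on_def by metis
    obtain j where j: "j \<in> I" using \<open>I \<noteq> {}\<close> by blast
    define d where "d k = coef k * cis (\<phi> k) * exp (of_real (\<sigma>\<^sub>0 * lam k))" for k
    have dnz: "d k \<noteq> 0 \<longleftrightarrow> k \<in> I" for k by (simp add: d_def dirichlet_nonzero)
    have "(\<Sum>k. d k * cis (lam k * s)) = 0" for s
      using g_zero[of s] unfolding g_def d_def exp_Complex by (simp add: mult.assoc)
    moreover have "summable (\<lambda>k. norm (d k))" using dirichlet_abs_summable[OF \<sigma>] by (simp add: d_def norm_mult)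
    ultimately have "has_mean (\<lambda>s. 0 * cis (- (lam j * s))) (sum d {k. d k \<noteq> 0 \<and> lam k = lam j})"
      using has_mean_exponential_series[of d lam "lam j"] dirichlet_inj by (simp add: dnz)
    moreover have "{k. d k \<noteq> 0 \<and> lam k = lam j} = {j}" using j dirichlet_inj by (auto simp: dnz inj_on_def)
    moreover have "has_mean (\<lambda>s. 0 * cis (- (lam j * s))) 0" by (simp add: has_mean_def)
    ultimately have "d j = 0" using has_mean_unique by fastforce
    with j dnz show False by blast
  qed
  moreover have "F n s \<noteq> 0" if "s \<in> S" for n s
  proof
    assume "F n s = 0"
    then have "dist (Re (s + \<i> * of_real (t n))) \<sigma>\<^sub>0 \<ge> e" unfolding F_def by (intro e(2) SU that)
    then show False using S(3)[OF that] by simp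
  qed
  ultimately have "g (Complex \<sigma>\<^sub>0 0) \<noteq> 0"
    using uniform_limit_on_subset[OF lim] by (intro Hurwitz_no_zeros[OF openS connS holF holg _ _ _ inS]) auto
  with g0 show False by simp
qed

end

theorem theorem6:
  fixes \<alpha> \<beta> :: ereal and f :: "complex \<Rightarrow> complex"
    and I :: "nat set" and a :: "nat \<Rightarrow> complex" and lam :: "nat \<Rightarrow> real" and \<sigma>\<^sub>0 :: real
  assumes "\<alpha> < \<beta>"
    and "almost_periodic_strip \<alpha> \<beta> f"
    and "is_dirichlet_series \<alpha> \<beta> f I a lam"
    and "rat_real.independent (lam ` I)"
    and "infinite (lam ` I) \<or> card (lam ` I) \<ge> 3"
    and "\<alpha> < ereal \<sigma>\<^sub>0" and "ereal \<sigma>\<^sub>0 < \<beta>"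
  shows "\<sigma>\<^sub>0 \<in> zero_abscissae \<alpha> \<beta> f \<longleftrightarrow>
    (\<forall>j\<in>I. ennreal (norm (a j) * exp (\<sigma>\<^sub>0 * lam j))
        \<le> (\<Sum>\<^sub>\<infinity>i\<in>I - {j}. ennreal (norm (a i) * exp (\<sigma>\<^sub>0 * lam i))))"
proof -
  interpret ap_dirichlet_series \<alpha> \<beta> f I a lam
    using assms by unfold_locales
  define r where "r = (\<lambda>n. norm (coef n) * exp (\<sigma>\<^sub>0 * lam n))"
  have sum: "summable r" unfolding r_def by (rule dirichlet_abs_summable[OF assms(6,7)])
  have r0: "r n \<ge> 0" for n by (simp add: r_def)
  have "I \<noteq> {}" using assms(5) by auto
  have cond: "ennreal (norm (a j) * exp (\<sigma>\<^sub>0 * lam j)) \<le> (\<Sum>\<^sub>\<infinity>i\<in>I - {j}. ennreal (norm (a i) * exp (\<sigma>\<^sub>0 * lam i)))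
      \<longleftrightarrow> 2 * r j \<le> suminf r" if "j \<in> I" for j
  proof -
    have "(\<Sum>\<^sub>\<infinity>i\<in>I - {j}. ennreal (norm (a i) * exp (\<sigma>\<^sub>0 * lam i))) = (\<Sum>\<^sub>\<infinity>i\<in>I - {j}. ennreal (r i))"
      by (rule infsum_cong) (simp add: r_def coef_def)
    also have "\<dots> = ennreal (\<Sum>i. if i \<in> I - {j} then r i else 0)" by (rule infsum_ennreal_eq_suminf[OF r0 sum])
    also have "(\<lambda>i. if i \<in> I - {j} then r i else 0) = (\<lambda>i. if i = j then 0 else r i)"
      by (auto simp: r_def coef_def)
    also have "suminf \<dots> = suminf r - r j" using suminf_remove[OF sum, of j] by (simp add: sums_iff)
    finally have *: "(\<Sum>\<^sub>\<infinity>i\<in>I - {j}. ennreal (norm (a i) * exp (\<sigma>\<^sub>0 * lam i))) = ennreal (suminf r - r j)" .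
    have "norm (a j) * exp (\<sigma>\<^sub>0 * lam j) = r j" using that by (simp add: r_def coef_def)
    \<comment> \<open>\<open>ennreal\<close> sends negative numbers to 0, so the difference must be
      known to be nonnegative before the inequality is read in the reals.\<close>
    moreover have "r j \<le> suminf r"
      using sum_le_suminf[OF sum, of "{j}"] r0 by simp
    ultimately show ?thesis unfolding * by (simp add: ennreal_le_iff algebra_simps)
  qed
  show ?thesis
  proof
    assume "\<sigma>\<^sub>0 \<in> zero_abscissae \<alpha> \<beta> f"
    then have "2 * r j \<le> suminf r" for j
      using dominant_term_not_zero_abscissa[OF assms(6,7), of j] unfolding r_def by (meson not_less)
    with cond show "\<forall>j\<in>I. ennreal (norm (a j) * exp (\<sigma>\<^sub>0 * lam j)) \<le> (\<Sum>\<^sub>\<infinity>i\<in>I - {j}. ennreal (norm (a i) * exp (\<sigma>\<^sub>0 * lam i)))"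
      by blast
  next
    assume *: "\<forall>j\<in>I. ennreal (norm (a j) * exp (\<sigma>\<^sub>0 * lam j)) \<le> (\<Sum>\<^sub>\<infinity>i\<in>I - {j}. ennreal (norm (a i) * exp (\<sigma>\<^sub>0 * lam i)))"
    \<comment> \<open>The inequality is required for every natural \<open>j\<close>; outside
      \<open>I\<close> the padded term is 0.\<close>
    have "2 * r j \<le> suminf r" for j
    proof (cases "j \<in> I")
      case False
      then have "r j = 0" by (simp add: r_def coef_def)
      then show ?thesis using suminf_nonneg[OF sum r0] by simp
    qed (use * cond in blast)
    then show "\<sigma>\<^sub>0 \<in> zero_abscissae \<alpha> \<beta> f"
      unfolding r_def by (intro balanced_terms_zero_abscissa[OF assms(6,7) \<open>I \<noteq> {}\<close>])
  qed
qed

end
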